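(* Let $\mathbb{k}$ be a field and let $P$ be a finite lower Eulerian poset which is Cohen-Macaulay over $\mathbb{k}$, with minimum element $\hat{0}$ and set of atoms $\mathcal{A}(P)$. Let $\hat{P} = P \cup \{\hat{1}\}$ be the poset obtained from $P$ by attaching a maximum element $\hat{1}$ and let $\mu_{\hat{P}}$ denote the Möbius function of $\hat{P}$. Then $$\sum_{x \in \mathcal{A}(P)} |\mu_{\hat{P}}(x, \hat{1})| \ \ge \ \alpha_P \, |\mu_{\hat{P}}(\hat{0}, \hat{1})|,$$ where $\alpha_P$ is the minimum, over all maximal elements $y$ of $P$, of the cardinality of the set $\{x \in \mathcal{A}(P) : x \le_P y\}$.
   Context: A finite poset $P$ with a minimum element $\hat{0}$ is called lower Eulerian if every closed interval $[x,y]$ of $P$ is graded (all maximal chains of $[x,y]$ have the same length $\rho(x,y)$) and $\mu_P(x,y) = (-1)^{\rho(x,y)}$ for all $x \le_P y$, where $\mu_P$ is the Möbius function of $P$. A simplicial complex $\Delta$ is Cohen-Macaulay over $\mathbb{k}$ if $\widetilde{H}_i(\mathrm{lk}_\Delta(\sigma);\mathbb{k}) = 0$ for every face $\sigma \in \Delta$ (including $\sigma=\varnothing$) and all $i < \dim \mathrm{lk}_\Delta(\sigma)$, where $\mathrm{lk}_\Delta(\sigma) = \{\tau \setminus \sigma : \sigma \subseteq \tau \in \Delta\}$. A finite poset is Cohen-Macaulay over $\mathbb{k}$ if its order complex (the simplicial complex of its chains) is Cohen-Macaulay over $\mathbb{k}$. *)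

theory Defs
  imports Main
begin

section \<open>Finite posets\<close>

text \<open>
  A poset is a carrier \<open>P\<close> together with a relation \<open>r\<close> such that \<^term>\<open>partial_order_on P r\<close>;
  \<^prop>\<open>(x, y) \<in> r\<close> means \<open>x \<le> y\<close>.
\<close>

definition is_minimum :: "'a set \<Rightarrow> 'a rel \<Rightarrow> 'a \<Rightarrow> bool" where
  "is_minimum P r z \<longleftrightarrow> z \<in> P \<and> (\<forall>x\<in>P. (z, x) \<in> r)"

definition maximal_elements :: "'a set \<Rightarrow> 'a rel \<Rightarrow> 'a set" where
  "maximal_elements P r = {y \<in> P. \<forall>x\<in>P. (y, x) \<in> r \<longrightarrow> x = y}"

text \<open>The atoms of a poset with minimum \<open>z\<close>, that is, the elements covering \<open>z\<close>.\<close>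

definition atoms :: "'a set \<Rightarrow> 'a rel \<Rightarrow> 'a \<Rightarrow> 'a set" where
  "atoms P r z = {x \<in> P. x \<noteq> z \<and> (\<forall>w\<in>P. (w, x) \<in> r \<longrightarrow> w = z \<or> w = x)}"

definition interval :: "'a set \<Rightarrow> 'a rel \<Rightarrow> 'a \<Rightarrow> 'a \<Rightarrow> 'a set" where
  "interval P r x y = {z \<in> P. (x, z) \<in> r \<and> (z, y) \<in> r}"

text \<open>
  The Moebius function, by \<open>\<mu>(x,x) = 1\<close> and \<open>\<mu>(x,y) = - (\<Sum>x \<le> z < y. \<mu>(x,z))\<close> for \<open>x < y\<close>.
  It is extended by \<open>0\<close> to pairs with \<open>x \<not>\<le> y\<close>; the remaining conditions in the guard (a finite
  poset) are there to make the recursion terminate.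
\<close>

function mobius :: "'a set \<Rightarrow> 'a rel \<Rightarrow> 'a \<Rightarrow> 'a \<Rightarrow> int" where
  "mobius P r x y =
    (if finite P \<and> partial_order_on P r \<and> (x, y) \<in> r
     then if x = y then 1 else - (\<Sum>z \<in> interval P r x y - {y}. mobius P r x z)
     else 0)"
  by pat_completeness auto
termination
proof (relation "measure (\<lambda>(P, r, x, y). card (interval P r x y))", simp, clarsimp)
  fix P :: "'a set" and r x y z
  assume fin: "finite P" and po: "partial_order_on P r" and xy: "(x, y) \<in> r"
    and z: "z \<in> interval P r x y" "z \<noteq> y"
  have tr: "trans r" and an: "antisym r" and re: "refl_on P r" and sub: "r \<subseteq> P \<times> P"
    using partial_order_onD[OF po] by auto
  have "y \<in> interval P r x y" "y \<notin> interval P r x z"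
    using z xy sub re an by (auto simp: interval_def refl_on_def dest: antisymD)
  moreover have "interval P r x z \<subseteq> interval P r x y"
    using z tr by (auto simp: interval_def dest: transD)
  ultimately have "interval P r x z \<subset> interval P r x y" by auto
  moreover have "finite (interval P r x y)" using fin by (simp add: interval_def)
  ultimately show "card (interval P r x z) < card (interval P r x y)"
    by (rule psubset_card_mono[rotated])
qed

declare mobius.simps [simp del]

text \<open>\<open>Q\<close> is a subset of the poset, considered with the induced order.\<close>

definition maximal_chains :: "'a set \<Rightarrow> 'a rel \<Rightarrow> 'a set set" where
  "maximal_chains Q r =
    {C \<in> Chains r. C \<subseteq> Q \<and> (\<forall>D\<in>Chains r. C \<subseteq> D \<and> D \<subseteq> Q \<longrightarrow> D = C)}"

text \<open>A chain with \<open>n + 1\<close> elements has length \<open>n\<close>.\<close>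

definition graded :: "'a set \<Rightarrow> 'a rel \<Rightarrow> bool" where
  "graded Q r \<longleftrightarrow> (\<exists>n. \<forall>C\<in>maximal_chains Q r. card C - 1 = n)"

definition rho :: "'a set \<Rightarrow> 'a rel \<Rightarrow> 'a \<Rightarrow> 'a \<Rightarrow> nat" where
  "rho P r x y = (THE n. \<exists>C\<in>maximal_chains (interval P r x y) r. card C - 1 = n)"

definition lower_eulerian :: "'a set \<Rightarrow> 'a rel \<Rightarrow> bool" where
  "lower_eulerian P r \<longleftrightarrow>
    finite P \<and> partial_order_on P r \<and> (\<exists>z. is_minimum P r z) \<and>
    (\<forall>x\<in>P. \<forall>y\<in>P. (x, y) \<in> r \<longrightarrow>
      graded (interval P r x y) r \<and> mobius P r x y = (- 1) ^ rho P r x y)"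

text \<open>Attaching a maximum element \<^const>\<open>None\<close>.\<close>

definition hat_carrier :: "'a set \<Rightarrow> 'a option set" where
  "hat_carrier P = insert None (Some ` P)"

definition hat_rel :: "'a set \<Rightarrow> 'a rel \<Rightarrow> 'a option rel" where
  "hat_rel P r = {(Some x, Some y) | x y. (x, y) \<in> r} \<union> hat_carrier P \<times> {None}"

lemma partial_order_on_hat:
  assumes "partial_order_on P r"
  shows "partial_order_on (hat_carrier P) (hat_rel P r)"
proof -
  note po = partial_order_onD[OF assms]
  have "hat_rel P r \<subseteq> hat_carrier P \<times> hat_carrier P"
    using po(4) by (auto simp: hat_rel_def hat_carrier_def)
  moreover have "refl_on (hat_carrier P) (hat_rel P r)"
    using po(1) by (auto simp: refl_on_def hat_rel_def hat_carrier_def)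
  moreover have "trans (hat_rel P r)"
  proof (rule transI)
    fix a b c assume "(a, b) \<in> hat_rel P r" "(b, c) \<in> hat_rel P r"
    then show "(a, c) \<in> hat_rel P r"
      using po(4) transD[OF po(2)] by (fastforce simp: hat_rel_def hat_carrier_def)
  qed
  moreover have "antisym (hat_rel P r)"
  proof (rule antisymI)
    fix a b assume "(a, b) \<in> hat_rel P r" "(b, a) \<in> hat_rel P r"
    then show "a = b"
      using antisymD[OF po(3)] by (auto simp: hat_rel_def)
  qed
  ultimately show ?thesis by (simp add: partial_order_on_def preorder_on_def)
qed

definition alpha :: "'a set \<Rightarrow> 'a rel \<Rightarrow> 'a \<Rightarrow> nat" where
  "alpha P r z = Min ((\<lambda>y. card {x \<in> atoms P r z. (x, y) \<in> r}) ` maximal_elements P r)"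


section \<open>Reduced simplicial homology\<close>

text \<open>
  A finite simplicial complex is a finite set of finite sets (its faces, including the empty face)
  closed under subsets.

  The space of oriented \<open>i\<close>-chains over \<open>'k\<close>: an ordered \<open>i\<close>-simplex is a list without
  repetitions whose elements form an \<open>i\<close>-dimensional face, and a chain is a function on ordered
  \<open>i\<close>-simplices (extended by \<open>0\<close> to all other lists) which changes sign under transposition of two
  neighbouring vertices, hence is multiplied by the sign under any permutation of the vertices.
  For \<open>i = -1\<close> the only ordered simplex is the empty list, so the complex is the augmented one.
\<close>

definition oriented_chains :: "'a set set \<Rightarrow> int \<Rightarrow> ('a list \<Rightarrow> 'k::field) set" where
  "oriented_chains \<Delta> i =
    {c. (\<forall>xs. c xs \<noteq> 0 \<longrightarrow> distinct xs \<and> set xs \<in> \<Delta> \<and> int (length xs) = i + 1) \<and>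
        (\<forall>xs a b ys. c (xs @ a # b # ys) = - c (xs @ b # a # ys))}"

text \<open>
  The usual boundary \<open>\<partial>[v\<^sub>0,\<dots>,v\<^sub>i] = (\<Sum>j. (-1)\<^sup>j [v\<^sub>0,\<dots>,v\<^sub>j\<^sub>-\<^sub>1,v\<^sub>j\<^sub>+\<^sub>1,\<dots>,v\<^sub>i])\<close>, written
  in coefficients: after moving the omitted vertex to the front, the simplices having \<open>[w\<^sub>1,\<dots>,w\<^sub>i]\<close>
  in their boundary are the \<open>[v,w\<^sub>1,\<dots>,w\<^sub>i]\<close>, each with coefficient \<open>1\<close>.
\<close>

definition boundary_map :: "'a set set \<Rightarrow> ('a list \<Rightarrow> 'k::field) \<Rightarrow> 'a list \<Rightarrow> 'k" where
  "boundary_map \<Delta> c = (\<lambda>w. \<Sum>v\<in>\<Union>\<Delta>. c (v # w))"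

definition cycles :: "'a set set \<Rightarrow> int \<Rightarrow> ('a list \<Rightarrow> 'k::field) set" where
  "cycles \<Delta> i = {c \<in> oriented_chains \<Delta> i. boundary_map \<Delta> c = (\<lambda>w. 0)}"

definition boundaries :: "'a set set \<Rightarrow> int \<Rightarrow> ('a list \<Rightarrow> 'k::field) set" where
  "boundaries \<Delta> i = boundary_map \<Delta> ` oriented_chains \<Delta> (i + 1)"

text \<open>The quotient of cycles by boundaries, as a set of cosets; its zero is the space of boundaries.\<close>

definition reduced_homology :: "'a set set \<Rightarrow> int \<Rightarrow> ('a list \<Rightarrow> 'k::field) set set" where
  "reduced_homology \<Delta> i =
    cycles \<Delta> i // {(c, d). c \<in> cycles \<Delta> i \<and> d \<in> cycles \<Delta> i \<and> (\<lambda>w. c w - d w) \<in> boundaries \<Delta> i}"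

definition reduced_homology_vanishes :: "'k::field itself \<Rightarrow> 'a set set \<Rightarrow> int \<Rightarrow> bool" where
  "reduced_homology_vanishes K \<Delta> i \<longleftrightarrow>
    (reduced_homology \<Delta> i :: ('a list \<Rightarrow> 'k) set set) = {boundaries \<Delta> i}"

lemma boundary_map_in_oriented_chains:
  fixes c :: "'a list \<Rightarrow> 'k::field"
  assumes down: "\<And>s t. s \<in> \<Delta> \<Longrightarrow> t \<subseteq> s \<Longrightarrow> t \<in> \<Delta>"
    and c: "c \<in> oriented_chains \<Delta> (i + 1)"
  shows "boundary_map \<Delta> c \<in> oriented_chains \<Delta> i"
proof -
  have supp: "distinct xs \<and> set xs \<in> \<Delta> \<and> int (length xs) = i + 2" if "c xs \<noteq> 0" for xs
  proof -
    have "int (length xs) = i + 1 + 1" "distinct xs" "set xs \<in> \<Delta>"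
      using c that unfolding oriented_chains_def by blast+
    then show ?thesis by simp
  qed
  have swap: "c (xs @ a # b # ys) = - c (xs @ b # a # ys)" for xs a b ys
    using c unfolding oriented_chains_def by blast
  have "distinct xs \<and> set xs \<in> \<Delta> \<and> int (length xs) = i + 1" if nz: "boundary_map \<Delta> c xs \<noteq> 0" for xs
  proof -
    obtain v where "c (v # xs) \<noteq> 0"
      using nz unfolding boundary_map_def by (meson sum.not_neutral_contains_not_neutral)
    from supp[OF this] down show ?thesis by auto
  qed
  moreover have "boundary_map \<Delta> c (xs @ a # b # ys) = - boundary_map \<Delta> c (xs @ b # a # ys)" for xs a b ys
  proof -
    have "c (v # xs @ a # b # ys) = - c (v # xs @ b # a # ys)" for v
      using swap[of "v # xs" a b ys] unfolding append_Cons .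
    then show ?thesis unfolding boundary_map_def sum_negf[symmetric] by (intro sum.cong refl)
  qed
  ultimately show ?thesis unfolding oriented_chains_def by blast
qed

text \<open>No division by two is used: the diagonal terms vanish because ordered simplices are distinct.\<close>

lemma boundary_map_boundary_map:
  fixes c :: "'a list \<Rightarrow> 'k::field"
  assumes fin: "finite (\<Union>\<Delta>)" and c: "c \<in> oriented_chains \<Delta> i"
  shows "boundary_map \<Delta> (boundary_map \<Delta> c) = (\<lambda>w. 0)"
proof
  fix w
  have swap: "c (u # v # w) = - c (v # u # w)" for u v
  proof -
    have "c ([] @ u # v # w) = - c ([] @ v # u # w)"
      using c unfolding oriented_chains_def by blast
    then show ?thesis by simp
  qed
  have diag: "c (v # v # w) = 0" for v
  proof (rule ccontr)
    assume "c (v # v # w) \<noteq> 0"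
    then have "distinct (v # v # w)" using c unfolding oriented_chains_def by blast
    then show False by simp
  qed
  have "(\<Sum>v\<in>V. \<Sum>u\<in>V. c (u # v # w)) = 0" if "finite V" for V
    using that
  proof (induction V rule: finite_induct)
    case (insert x V)
    have "(\<Sum>u\<in>V. c (u # x # w)) = - (\<Sum>v\<in>V. c (x # v # w))"
      unfolding sum_negf[symmetric] by (rule sum.cong, rule refl, rule swap)
    with insert show ?case by (simp add: sum.distrib diag)
  qed simp
  from this[OF fin] show "boundary_map \<Delta> (boundary_map \<Delta> c) w = 0"
    by (simp add: boundary_map_def)
qed


section \<open>Cohen--Macaulay complexes and posets\<close>

definition link :: "'a set set \<Rightarrow> 'a set \<Rightarrow> 'a set set" where
  "link \<Delta> \<sigma> = {\<tau> - \<sigma> | \<tau>. \<sigma> \<subseteq> \<tau> \<and> \<tau> \<in> \<Delta>}"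

definition complex_dim :: "'a set set \<Rightarrow> int" where
  "complex_dim \<Delta> = Max ((\<lambda>\<sigma>. int (card \<sigma>) - 1) ` \<Delta>)"

definition cohen_macaulay_complex :: "'k::field itself \<Rightarrow> 'a set set \<Rightarrow> bool" where
  "cohen_macaulay_complex K \<Delta> \<longleftrightarrow>
    (\<forall>\<sigma>\<in>\<Delta>. \<forall>i < complex_dim (link \<Delta> \<sigma>). reduced_homology_vanishes K (link \<Delta> \<sigma>) i)"

definition order_complex :: "'a set \<Rightarrow> 'a rel \<Rightarrow> 'a set set" where
  "order_complex P r = {C \<in> Chains r. C \<subseteq> P}"

definition cohen_macaulay_poset :: "'k::field itself \<Rightarrow> 'a set \<Rightarrow> 'a rel \<Rightarrow> bool" where
  "cohen_macaulay_poset K P r \<longleftrightarrow> cohen_macaulay_complex K (order_complex P r)"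

end

theory Submission
  imports Defs HOL.Vector_Spaces "HOL-Library.Function_Algebras" "HOL-Library.Multiset"
begin

text \<open>
  Let \<open>Q\<close> be \<open>P\<close> without its minimum. By Hall's theorem, the Euler--Poincare formula and the
  Cohen--Macaulay property, \<open>|\<mu>(0,1)|\<close> and \<open>|\<mu>(x,1)|\<close> are the dimensions of the spaces of top cycles
  of the order complex of \<open>Q\<close> and of the link of the atom \<open>x\<close> in it. The diamond property of Eulerian
  intervals and strong connectivity of Cohen--Macaulay complexes show that the coefficients of a top
  cycle on the facets through a fixed maximal element \<open>y\<close> either all vanish or are all nonzero. Hence
  a top cycle is determined by one coefficient per maximal element, and there are a set \<open>S\<close> of
  \<open>|\<mu>(0,1)|\<close> maximal elements and a basis \<open>c\<^sub>y\<close> (\<open>y \<in> S\<close>) of the top cycles dual to the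
  coefficients at \<open>S\<close>. For an atom \<open>x\<close>, the parts of the \<open>c\<^sub>y\<close> with \<open>x \<le> y\<close> that contain \<open>x\<close> give
  linearly independent top cycles of the link of \<open>x\<close>, so \<open>|\<mu>(x,1)|\<close> is at least the number of
  \<open>y \<in> S\<close> above \<open>x\<close>. Summing over \<open>x\<close> gives the inequality.
\<close>

section \<open>Linear algebra\<close>

text \<open>Expanding \<open>x\<close> over \<open>A\<close> and over \<open>B\<close> and
  subtracting gives a linear relation on \<open>A \<union> B\<close>, whose coefficients on
  \<open>A\<close> must all vanish.\<close>

lemma (in vector_space) span_Int_span_disjoint:
  assumes "independent (A \<union> B)" "finite A" "finite B" "A \<inter> B = {}" "x \<in> span A" "x \<in> span B"
  shows "x = 0"
proof -
  obtain a where a: "x = (\<Sum>v\<in>A. scale (a v) v)" using assms by (auto simp: span_finite)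
  obtain b where b: "x = (\<Sum>v\<in>B. scale (b v) v)" using assms by (auto simp: span_finite)
  let ?u = "\<lambda>v. if v \<in> A then a v else - b v"
  have "(\<Sum>v\<in>A \<union> B. scale (?u v) v) = (\<Sum>v\<in>A. scale (?u v) v) + (\<Sum>v\<in>B. scale (?u v) v)"
    using assms by (intro sum.union_disjoint) auto
  also have "(\<Sum>v\<in>A. scale (?u v) v) = x" unfolding a by (rule sum.cong) auto
  also have "(\<Sum>v\<in>B. scale (?u v) v) = - x"
    unfolding b sum_negf[symmetric] using assms(4) by (intro sum.cong) auto
  finally have "(\<Sum>v\<in>A \<union> B. scale (?u v) v) = 0" by simp
  then have "?u v = 0" if "v \<in> A" for v
    using independentD[OF assms(1), of "A \<union> B" ?u v] assms(2,3) that by auto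
  then show ?thesis unfolding a by (intro sum.neutral) auto
qed

text \<open>A basis \<open>K\<close> of the kernel is extended to a basis \<open>B\<close> of
  \<open>U\<close>. The span of \<open>B - K\<close> meets the kernel only in zero, so
  \<open>f\<close> carries \<open>B - K\<close> injectively to a basis of the image of
  \<open>U\<close>. The set \<open>T\<close> keeps these bases finite, as the ambient space may have
  infinite dimension.\<close>

lemma (in vector_space_pair) rank_nullity:
  assumes lf: "Vector_Spaces.linear s1 s2 f" and U: "vs1.subspace U" and T: "finite T" "U \<subseteq> vs1.span T"
  shows "vs1.dim U = vs1.dim {x \<in> U. f x = 0} + vs2.dim (f ` U)"
proof -
  let ?K = "{x \<in> U. f x = 0}"
  interpret f: Vector_Spaces.linear s1 s2 f by (rule lf)
  have sK: "vs1.subspace ?K"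
    using vs1.subspace_inter[OF U f.subspace_kernel] by (simp add: Int_def)
  obtain K where K: "K \<subseteq> ?K" "vs1.independent K" "?K \<subseteq> vs1.span K" "card K = vs1.dim ?K"
    by (rule vs1.basis_exists)
  obtain B where B: "K \<subseteq> B" "B \<subseteq> U" "vs1.independent B" "U \<subseteq> vs1.span B"
    using vs1.maximal_independent_subset_extend[of K U] K by auto
  have fin: "finite B" using vs1.independent_span_bound[OF T(1) B(3)] B T by auto
  have finK: "finite K" using finite_subset[OF B(1) fin] .
  let ?L = "B - K"
  have inj: "inj_on f (vs1.span ?L)"
    unfolding f.inj_on_iff_eq_0[OF vs1.subspace_span]
  proof (intro ballI impI)
    fix x assume x: "x \<in> vs1.span ?L" "f x = 0"
    have "vs1.span ?L \<subseteq> U" using B U by (intro vs1.span_minimal) auto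
    then have "x \<in> vs1.span K" using K x by auto
    moreover have "K \<union> ?L = B" using B by auto
    ultimately show "x = 0" using vs1.span_Int_span_disjoint[of K ?L x] x B fin finK by auto
  qed
  have ind: "vs2.independent (f ` ?L)"
    using B(3) vs1.independent_mono inj by (intro f.independent_injective_image) auto
  have "f ` U \<subseteq> vs2.span (f ` B)" using B(4) by (rule f.spans_image)
  also have "\<dots> \<subseteq> vs2.span (f ` ?L)"
  proof (rule vs2.span_minimal)
    show "f ` B \<subseteq> vs2.span (f ` ?L)"
    proof
      fix w assume "w \<in> f ` B"
      then obtain v where v: "v \<in> B" "w = f v" by auto
      show "w \<in> vs2.span (f ` ?L)"
      proof (cases "v \<in> K")
        case True
        then have "w = 0" using v K(1) by auto
        then show ?thesis by (simp add: vs2.span_zero)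
      qed (use v in \<open>auto intro: vs2.span_base\<close>)
    qed
  qed auto
  finally have "vs2.dim (f ` U) = card (f ` ?L)"
    using B by (intro vs2.dim_unique[OF _ _ ind]) auto
  also have "\<dots> = card ?L"
    using inj by (intro card_image) (meson inj_on_subset vs1.span_superset)
  also have "\<dots> + card K = card B"
    using B fin finK by (simp add: card_Diff_subset card_mono)
  also have "\<dots> = vs1.dim U" using B by (intro vs1.basis_card_eq_dim)
  finally show ?thesis using K(4) by simp
qed

section \<open>Function spaces over a field, with point evaluations as coordinates\<close>

definition fscale :: "'k::field \<Rightarrow> ('x \<Rightarrow> 'k) \<Rightarrow> 'x \<Rightarrow> 'k" where
  "fscale a f = (\<lambda>x. a * f x)"

interpretation fs: vector_space "fscale :: 'k::field \<Rightarrow> ('x \<Rightarrow> 'k) \<Rightarrow> 'x \<Rightarrow> 'k"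
  by unfold_locales (auto simp: fscale_def fun_eq_iff algebra_simps)

interpretation fsp: vector_space_pair
  "fscale :: 'k::field \<Rightarrow> ('x \<Rightarrow> 'k) \<Rightarrow> 'x \<Rightarrow> 'k" "fscale :: 'k::field \<Rightarrow> ('y \<Rightarrow> 'k) \<Rightarrow> 'y \<Rightarrow> 'k"
  by unfold_locales

lemma sum_apply: "(\<Sum>a\<in>A. f a) x = (\<Sum>a\<in>A. f a x)"
  by (induction A rule: infinite_finite_induct) (auto simp: zero_fun_def)

text \<open>Evaluating a linear relation among the \<open>u s\<close> at the point
  \<open>p s\<close> leaves the single term of \<open>u s\<close>.\<close>

lemma independent_triangular:
  fixes u :: "'s \<Rightarrow> 'x \<Rightarrow> 'k::field"
  assumes fin: "finite S"
    and diag: "\<And>s. s \<in> S \<Longrightarrow> u s (p s) \<noteq> 0"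
    and off: "\<And>s t. s \<in> S \<Longrightarrow> t \<in> S \<Longrightarrow> s \<noteq> t \<Longrightarrow> u s (p t) = 0"
  shows "inj_on u S" "fs.independent (u ` S)"
proof -
  show inj: "inj_on u S"
    by (rule inj_onI) (metis diag off)
  show "fs.independent (u ` S)"
  proof (rule fs.independent_if_scalars_zero)
    fix f x assume 0: "(\<Sum>x\<in>u ` S. fscale (f x) x) = 0" and x: "x \<in> u ` S"
    then obtain s where s: "s \<in> S" "x = u s" by auto
    have "0 = (\<Sum>t\<in>S. fscale (f (u t)) (u t)) (p s)"
      using 0 by (simp add: sum.reindex[OF inj] zero_fun_def)
    also have "\<dots> = (\<Sum>t\<in>S. f (u t) * u t (p s))" by (simp add: sum_apply fscale_def)
    also have "\<dots> = (\<Sum>t\<in>S. if t = s then f (u s) * u s (p s) else 0)"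
      using s off by (intro sum.cong) auto
    also have "\<dots> = f (u s) * u s (p s)" using s fin by simp
    finally show "f x = 0" using diag[OF s(1)] s by simp
  qed (use fin in auto)
qed

text \<open>This will bound the cycle space of a link from below. The finite \<open>T\<close> makes
  a basis of \<open>U\<close> finite, and the exchange bound compares it with the independent family
  \<open>u\<close>.\<close>

lemma card_le_dim_triangular:
  fixes u :: "'s \<Rightarrow> 'x \<Rightarrow> 'k::field"
  assumes fin: "finite S"
    and diag: "\<And>s. s \<in> S \<Longrightarrow> u s (p s) \<noteq> 0"
    and off: "\<And>s t. s \<in> S \<Longrightarrow> t \<in> S \<Longrightarrow> s \<noteq> t \<Longrightarrow> u s (p t) = 0"
    and U: "u ` S \<subseteq> U" "finite T" "U \<subseteq> fs.span T"
  shows "card S \<le> fs.dim U"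
proof -
  obtain B where B: "B \<subseteq> U" "fs.independent B" "U \<subseteq> fs.span B" "card B = fs.dim U"
    by (rule fs.basis_exists)
  have "finite B" using fs.independent_span_bound[OF U(2) B(2)] B U by auto
  moreover have "inj_on u S" "fs.independent (u ` S)"
    using independent_triangular[of S u p] fin diag off by blast+
  ultimately have "card (u ` S) \<le> card B" 
    using fs.independent_span_bound[of B "u ` S"] B U by auto
  then show ?thesis using \<open>inj_on u S\<close> B by (simp add: card_image)
qed

text \<open>Subtracting from \<open>c\<close> the combination of the \<open>u s\<close> with
  coefficients \<open>c (p s)\<close> leaves a member of \<open>U\<close> that vanishes at every
  \<open>p s\<close>, hence zero by \<open>det\<close>.\<close>

lemma dual_basis:
  fixes u :: "'s \<Rightarrow> 'x \<Rightarrow> 'k::field"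
  assumes U: "fs.subspace U" and fin: "finite S"
    and diag: "\<And>s. s \<in> S \<Longrightarrow> u s (p s) = 1"
    and off: "\<And>s t. s \<in> S \<Longrightarrow> t \<in> S \<Longrightarrow> s \<noteq> t \<Longrightarrow> u s (p t) = 0"
    and sub: "\<And>s. s \<in> S \<Longrightarrow> u s \<in> U"
    and det: "\<And>c. c \<in> U \<Longrightarrow> (\<And>s. s \<in> S \<Longrightarrow> c (p s) = 0) \<Longrightarrow> c = (\<lambda>x. 0)"
  shows "U \<subseteq> fs.span (u ` S)" "fs.dim U = card S"
proof -
  have *: "inj_on u S" "fs.independent (u ` S)"
    using independent_triangular[of S u p] fin diag off by auto
  show span: "U \<subseteq> fs.span (u ` S)"
  proof
    fix c assume c: "c \<in> U"
    let ?d = "\<Sum>s\<in>S. fscale (c (p s)) (u s)"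
    have "(c - ?d) (p t) = 0" if "t \<in> S" for t
    proof -
      have "?d (p t) = (\<Sum>s\<in>S. if s = t then c (p t) else 0)"
        unfolding sum_apply fscale_def using that diag off by (intro sum.cong) auto
      then show ?thesis using that fin by simp
    qed
    moreover have "c - ?d \<in> U"
      using U c sub by (intro fs.subspace_diff fs.subspace_sum fs.subspace_scale) auto
    ultimately have "c - ?d = 0" using det[of "c - ?d"] by (simp add: zero_fun_def)
    then have "c = ?d" by simp
    also have "\<dots> \<in> fs.span (u ` S)"
      by (intro fs.span_sum fs.span_scale fs.span_base) auto
    finally show "c \<in> fs.span (u ` S)" .
  qed
  show "fs.dim U = card S"
    using fs.dim_unique[OF _ span *(2)] sub * by (auto simp: card_image)
qed

text \<open>Take a subset \<open>S\<close> of \<open>M\<close> of least cardinality whose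
  evaluations still determine the members of \<open>U\<close>. Leaving out \<open>s\<close> loses
  this property, so some nonzero member of \<open>U\<close> vanishes at the other points of
  \<open>S\<close>. It cannot vanish at \<open>p s\<close>, and rescaling it gives
  \<open>u s\<close>.\<close>

lemma ex_dual_basis:
  fixes U :: "('x \<Rightarrow> 'k::field) set" and p :: "'s \<Rightarrow> 'x"
  assumes U: "fs.subspace U" and fin: "finite M"
    and det: "\<And>c. c \<in> U \<Longrightarrow> \<forall>s\<in>M. c (p s) = 0 \<Longrightarrow> c = (\<lambda>x. 0)"
  shows "\<exists>S u. S \<subseteq> M \<and> card S = fs.dim U \<and>
    (\<forall>s\<in>S. u s \<in> U \<and> u s (p s) = 1 \<and> (\<forall>t\<in>S. t \<noteq> s \<longrightarrow> u s (p t) = 0))"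
proof -
  let ?P = "\<lambda>S. S \<subseteq> M \<and> (\<forall>c\<in>U. (\<forall>s\<in>S. c (p s) = 0) \<longrightarrow> c = (\<lambda>x. 0))"
  have "\<exists>S. ?P S \<and> (\<forall>T. ?P T \<longrightarrow> card S \<le> card T)"
    using ex_has_least_nat[of ?P M card] det by auto
  then obtain S where S: "?P S" and min: "\<And>T. ?P T \<Longrightarrow> card S \<le> card T" by blast
  have finS: "finite S" using S fin finite_subset by auto
  have "\<exists>c\<in>U. c (p s) = 1 \<and> (\<forall>t\<in>S. t \<noteq> s \<longrightarrow> c (p t) = 0)" if s: "s \<in> S" for s
  proof -
    have "\<not> ?P (S - {s})" using min[of "S - {s}"] s finS card_Diff1_less[OF finS s] by auto
    then obtain c where c: "c \<in> U" "\<forall>t\<in>S - {s}. c (p t) = 0" "c \<noteq> (\<lambda>x. 0)" using S by auto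
    then have "c (p s) \<noteq> 0" using S by blast
    moreover from c have "fscale (1 / c (p s)) c \<in> U" by (intro fs.subspace_scale U)
    ultimately have "fscale (1 / c (p s)) c \<in> U" "fscale (1 / c (p s)) c (p s) = 1"
      "\<forall>t\<in>S. t \<noteq> s \<longrightarrow> fscale (1 / c (p s)) c (p t) = 0"
      using c by (auto simp: fscale_def)
    then show ?thesis by blast
  qed
  then obtain u where u: "\<And>s. s \<in> S \<Longrightarrow> u s \<in> U \<and> u s (p s) = 1 \<and> (\<forall>t\<in>S. t \<noteq> s \<longrightarrow> u s (p t) = 0)"
    by metis
  have "fs.dim U = card S"
    by (rule dual_basis[where u=u and p=p]) (use U finS u S in auto)
  then show ?thesis using u S by (intro exI[of _ S] exI[of _ u]) simp
qed

section \<open>The Euler--Poincare formula\<close>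

definition alternating :: "('a list \<Rightarrow> 'k::field) \<Rightarrow> bool" where
  "alternating c \<longleftrightarrow> (\<forall>xs a b ys. c (xs @ a # b # ys) = - c (xs @ b # a # ys))"

lemma alternatingD: "alternating c \<Longrightarrow> c (xs @ a # b # ys) = - c (xs @ b # a # ys)"
  unfolding alternating_def by blast

lemma alternating_swap: "alternating c \<Longrightarrow> c (a # b # ys) = - c (b # a # ys)"
  using alternatingD[of c "[]" a b ys] by simp

lemma alternating_Cons:
  assumes "alternating c" shows "alternating (\<lambda>w. c (x # w))"
  unfolding alternating_def
proof (intro allI)
  fix xs a b ys
  show "c (x # xs @ a # b # ys) = - c (x # xs @ b # a # ys)"
    using alternatingD[OF assms, of "x # xs" a b ys] by simp
qed

lemma alternating_move_front:
  assumes "alternating c"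
  shows "c (ys @ x # zs) = c (x # ys @ zs) \<or> c (ys @ x # zs) = - c (x # ys @ zs)"
  using assms
proof (induction ys arbitrary: c)
  case (Cons y ys)
  from Cons.IH[OF alternating_Cons[OF Cons.prems, of y]] alternating_swap[OF Cons.prems, of y x "ys @ zs"]
  show ?case by auto
qed simp

text \<open>The head of \<open>xs\<close> is moved to the front of \<open>ys\<close>, and the rest
  follows by induction. The sign stays undetermined, because later arguments ask only whether a
  coefficient vanishes.\<close>

lemma alternating_permute:
  assumes "alternating c" "mset xs = mset ys"
  shows "c xs = c ys \<or> c xs = - c ys"
  using assms
proof (induction xs arbitrary: c ys)
  case (Cons x xs)
  then obtain ys1 ys2 where ys: "ys = ys1 @ x # ys2"
    by (metis list.set_intros(1) set_mset_mset split_list)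
  then have "mset xs = mset (ys1 @ ys2)" using Cons.prems(2) by simp
  from Cons.IH[OF alternating_Cons[OF Cons.prems(1), of x] this]
    alternating_move_front[OF Cons.prems(1), of ys1 x ys2]
  show ?case unfolding ys by auto
qed simp

lemma alternating_eq_0_iff:
  assumes "alternating c" "distinct xs" "distinct ys" "set xs = set ys"
  shows "c xs = 0 \<longleftrightarrow> c ys = 0"
  using alternating_permute[OF assms(1), of xs ys] set_eq_iff_mset_eq_distinct[OF assms(2,3)] assms(4)
  by auto

text \<open>For distinct entries on which \<open>f\<close> is injective,
  \<open>(- 1) ^ inversions f xs\<close> is the sign of the permutation that sorts \<open>xs\<close>
  by \<open>f\<close>.\<close>

primrec inversions :: "('a \<Rightarrow> nat) \<Rightarrow> 'a list \<Rightarrow> nat" where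
  "inversions f [] = 0"
| "inversions f (x # xs) = length (filter (\<lambda>y. f y < f x) xs) + inversions f xs"

text \<open>The exchange affects only the pair itself: exactly one of its two orders is an
  inversion.\<close>

lemma inversions_swap:
  fixes f :: "'a \<Rightarrow> nat"
  assumes "f a \<noteq> f b"
  shows "(- 1 :: 'k::field) ^ inversions f (xs @ a # b # ys) = - ((- 1) ^ inversions f (xs @ b # a # ys))"
  using assms by (induction xs) (auto simp: power_add)

text \<open>The elementary chain of the simplex \<open>\<sigma>\<close>, oriented by the vertex
  order that \<open>f\<close> induces.\<close>

definition face_chain :: "('a \<Rightarrow> nat) \<Rightarrow> 'a set \<Rightarrow> 'a list \<Rightarrow> 'k::field" where
  "face_chain f \<sigma> xs = (if distinct xs \<and> set xs = \<sigma> then (- 1) ^ inversions f xs else 0)"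

lemma alternating_face_chain:
  assumes "inj_on f \<sigma>"
  shows "alternating (face_chain f \<sigma>)"
  unfolding alternating_def
proof (intro allI)
  fix xs a b ys
  show "face_chain f \<sigma> (xs @ a # b # ys) = - face_chain f \<sigma> (xs @ b # a # ys)"
  proof (cases "distinct (xs @ a # b # ys) \<and> set (xs @ a # b # ys) = \<sigma>")
    case True
    then have "f a \<noteq> f b" using assms by (auto dest: inj_onD)
    note inversions_swap[of f a b xs ys, OF this]
    moreover have "distinct (xs @ b # a # ys) \<and> set (xs @ b # a # ys) = \<sigma>" using True by auto
    ultimately show ?thesis
      using True by (simp add: face_chain_def del: distinct_append set_append)
  next
    case False
    moreover have "\<not> (distinct (xs @ b # a # ys) \<and> set (xs @ b # a # ys) = \<sigma>)" using False by auto
    ultimately show ?thesis unfolding face_chain_def by auto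
  qed
qed

section \<open>Chain and cycle spaces and their dimensions\<close>

lemma oriented_chains_iff:
  "c \<in> oriented_chains \<Delta> i \<longleftrightarrow>
    alternating c \<and> (\<forall>xs. c xs \<noteq> 0 \<longrightarrow> distinct xs \<and> set xs \<in> \<Delta> \<and> int (length xs) = i + 1)"
  unfolding oriented_chains_def alternating_def by blast

lemma subspace_oriented_chains:
  "fs.subspace (oriented_chains \<Delta> i :: ('a list \<Rightarrow> 'k::field) set)"
proof (rule fs.subspaceI)
  show "(0 :: 'a list \<Rightarrow> 'k) \<in> oriented_chains \<Delta> i"
    by (simp add: oriented_chains_iff alternating_def)
next
  fix c d :: "'a list \<Rightarrow> 'k" assume c: "c \<in> oriented_chains \<Delta> i" and d: "d \<in> oriented_chains \<Delta> i"
  then have "alternating c" "alternating d" by (auto simp: oriented_chains_iff)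
  then have "alternating (c + d)"
    unfolding alternating_def plus_fun_def by (metis minus_add_distrib)
  moreover have "c xs \<noteq> 0 \<or> d xs \<noteq> 0" if "(c + d) xs \<noteq> 0" for xs using that by auto
  ultimately show "c + d \<in> oriented_chains \<Delta> i" using c d unfolding oriented_chains_iff by blast
next
  fix a :: 'k and c :: "'a list \<Rightarrow> 'k" assume c: "c \<in> oriented_chains \<Delta> i"
  then have "alternating (fscale a c)"
    unfolding oriented_chains_iff alternating_def fscale_def by (metis mult_minus_right)
  then show "fscale a c \<in> oriented_chains \<Delta> i"
    using c by (simp add: oriented_chains_iff fscale_def)
qed

lemma linear_boundary_map:
  "Vector_Spaces.linear fscale fscale (boundary_map \<Delta> :: ('a list \<Rightarrow> 'k::field) \<Rightarrow> _)"
  unfolding linear_iff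
proof (intro conjI allI fs.vector_space_axioms)
  fix c d :: "'a list \<Rightarrow> 'k" and a :: 'k
  show "boundary_map \<Delta> (c + d) = boundary_map \<Delta> c + boundary_map \<Delta> d"
    by (simp add: boundary_map_def fun_eq_iff sum.distrib)
  show "boundary_map \<Delta> (fscale a c) = fscale a (boundary_map \<Delta> c)"
    by (simp add: boundary_map_def fscale_def sum_distrib_left)
qed

lemma subspace_cycles: "fs.subspace (cycles \<Delta> i :: ('a list \<Rightarrow> 'k::field) set)"
proof -
  interpret b: Vector_Spaces.linear fscale fscale "boundary_map \<Delta> :: ('a list \<Rightarrow> 'k) \<Rightarrow> _"
    by (rule linear_boundary_map)
  have "cycles \<Delta> i = oriented_chains \<Delta> i \<inter> {c. boundary_map \<Delta> c = (0 :: _ \<Rightarrow> 'k)}"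
    by (auto simp: cycles_def zero_fun_def)
  then show ?thesis
    using fs.subspace_inter[OF subspace_oriented_chains b.subspace_kernel] by metis
qed

definition listing :: "'a set \<Rightarrow> 'a list" where
  "listing \<sigma> = (SOME xs. distinct xs \<and> set xs = \<sigma>)"

lemma listing:
  assumes "finite \<sigma>"
  shows "distinct (listing \<sigma>)" "set (listing \<sigma>) = \<sigma>"
  using someI_ex[of "\<lambda>xs. distinct xs \<and> set xs = \<sigma>"] finite_distinct_list[OF assms]
  unfolding listing_def by auto

text \<open>The elementary chains of the faces of the right size form a basis dual to evaluation at
  the listings. The second claim supplies the finite spanning set that the dimension lemmas ask
  for.\<close>

lemma dim_oriented_chains:
  fixes \<Delta> :: "'a set set"
  assumes fin: "finite \<Delta>" and finf: "\<And>\<sigma>. \<sigma> \<in> \<Delta> \<Longrightarrow> finite \<sigma>"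
  shows "fs.dim (oriented_chains \<Delta> i :: ('a list \<Rightarrow> 'k::field) set) = card {\<sigma> \<in> \<Delta>. int (card \<sigma>) = i + 1}"
    and "\<exists>T. finite T \<and> oriented_chains \<Delta> i \<subseteq> fs.span (T :: ('a list \<Rightarrow> 'k::field) set)"
proof -
  have "finite (\<Union>\<Delta>)" using fin finf by auto
  then obtain f :: "'a \<Rightarrow> nat" where f: "inj_on f (\<Union>\<Delta>)"
    using finite_imp_inj_to_nat_seg by blast
  let ?S = "{\<sigma> \<in> \<Delta>. int (card \<sigma>) = i + 1}"
  let ?C = "oriented_chains \<Delta> i :: ('a list \<Rightarrow> 'k) set"
  \<comment> \<open>The sign factor is its own inverse and makes the value at
    \<open>listing \<sigma>\<close> equal to 1.\<close>
  let ?u = "\<lambda>\<sigma>. fscale ((- 1) ^ inversions f (listing \<sigma>)) (face_chain f \<sigma>) :: 'a list \<Rightarrow> 'k"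
  have sub: "?u \<sigma> \<in> ?C" if "\<sigma> \<in> ?S" for \<sigma>
  proof -
    have "inj_on f \<sigma>" using f that by (auto intro: inj_on_subset)
    then have "face_chain f \<sigma> \<in> ?C"
      using that by (auto simp: oriented_chains_iff alternating_face_chain face_chain_def distinct_card)
    then show ?thesis by (rule fs.subspace_scale[OF subspace_oriented_chains])
  qed
  have diag: "?u \<sigma> (listing \<sigma>) = 1" if "\<sigma> \<in> ?S" for \<sigma>
    using listing[of \<sigma>] finf[of \<sigma>] that
    by (simp add: fscale_def face_chain_def)
  have off: "?u \<sigma> (listing \<tau>) = 0" if "\<sigma> \<in> ?S" "\<tau> \<in> ?S" "\<sigma> \<noteq> \<tau>" for \<sigma> \<tau>
    using listing[of \<tau>] finf[of \<tau>] that by (simp add: fscale_def face_chain_def)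
  have det: "c = (\<lambda>x. 0)" if c: "c \<in> ?C" and 0: "\<And>\<sigma>. \<sigma> \<in> ?S \<Longrightarrow> c (listing \<sigma>) = 0" for c
  proof
    fix xs
    show "c xs = 0"
    proof (rule ccontr)
      assume "c xs \<noteq> 0"
      then have xs: "distinct xs" "set xs \<in> ?S" and alt: "alternating c"
        using c by (auto simp: oriented_chains_iff distinct_card)
      then have "c (listing (set xs)) \<noteq> 0"
        using alternating_eq_0_iff[OF alt xs(1), of "listing (set xs)"] \<open>c xs \<noteq> 0\<close> listing[of "set xs"]
        by auto
      then show False using 0 xs by auto
    qed
  qed
  have finS: "finite ?S" using fin by auto
  have dual: "?C \<subseteq> fs.span (?u ` ?S)" "fs.dim ?C = card ?S"
    by (rule dual_basis[OF subspace_oriented_chains finS, where u = ?u and p = listing];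
        fact diag off sub det)+
  then show "fs.dim ?C = card ?S" by simp
  from dual(1) finS show "\<exists>T. finite T \<and> ?C \<subseteq> fs.span T" by blast
qed

text \<open>The zero function is a boundary, so a cycle lies in its own coset; by assumption that
  coset is the set of boundaries.\<close>

lemma reduced_homology_vanishesD:
  fixes \<Delta> :: "'a set set"
  assumes "reduced_homology_vanishes TYPE('k::field) \<Delta> i"
  shows "(cycles \<Delta> i :: ('a list \<Rightarrow> 'k) set) \<subseteq> boundaries \<Delta> i"
proof
  fix c :: "'a list \<Rightarrow> 'k" assume c: "c \<in> cycles \<Delta> i"
  let ?R = "{(c, d). c \<in> cycles \<Delta> i \<and> d \<in> cycles \<Delta> i \<and> (\<lambda>w. c w - d w :: 'k) \<in> boundaries \<Delta> i}"
  have "(\<lambda>w. 0) \<in> (boundaries \<Delta> i :: ('a list \<Rightarrow> 'k) set)"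
    unfolding boundaries_def
    by (rule image_eqI[of _ _ 0])
      (simp_all add: boundary_map_def fs.subspace_0[OF subspace_oriented_chains])
  then have "c \<in> ?R `` {c}" using c by auto
  moreover have "?R `` {c} \<in> reduced_homology \<Delta> i"
    unfolding reduced_homology_def using c by (rule quotientI)
  ultimately show "c \<in> boundaries \<Delta> i"
    using assms unfolding reduced_homology_vanishes_def by auto
qed

section \<open>Finite complexes and the alternating count of their faces\<close>

locale simplicial_complex =
  fixes \<Delta> :: "'a set set"
  assumes finite_complex: "finite \<Delta>"
    and finite_face: "\<sigma> \<in> \<Delta> \<Longrightarrow> finite \<sigma>"
    and down_closed: "\<sigma> \<in> \<Delta> \<Longrightarrow> \<tau> \<subseteq> \<sigma> \<Longrightarrow> \<tau> \<in> \<Delta>"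
    and empty_face: "{} \<in> \<Delta>"
begin

lemma finite_vertices: "finite (\<Union>\<Delta>)"
  using finite_complex finite_face by auto

lemma card_le_complex_dim: "\<sigma> \<in> \<Delta> \<Longrightarrow> int (card \<sigma>) \<le> complex_dim \<Delta> + 1"
  unfolding complex_dim_def diff_le_eq[symmetric] using finite_complex by (intro Max_ge) auto

lemma complex_dim_face:
  obtains \<sigma> where "\<sigma> \<in> \<Delta>" "int (card \<sigma>) = complex_dim \<Delta> + 1"
proof -
  have "complex_dim \<Delta> \<in> (\<lambda>\<sigma>. int (card \<sigma>) - 1) ` \<Delta>"
    unfolding complex_dim_def using finite_complex empty_face by (intro Max_in) auto
  then show ?thesis using that by auto
qed

lemma boundaries_subset_cycles: "(boundaries \<Delta> i :: ('a list \<Rightarrow> 'k::field) set) \<subseteq> cycles \<Delta> i"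
proof
  fix b :: "'a list \<Rightarrow> 'k" assume "b \<in> boundaries \<Delta> i"
  then obtain c where c: "c \<in> oriented_chains \<Delta> (i + 1)" "b = boundary_map \<Delta> c"
    by (auto simp: boundaries_def)
  then show "b \<in> cycles \<Delta> i"
    using boundary_map_in_oriented_chains[OF down_closed c(1)] boundary_map_boundary_map[OF finite_vertices c(1)]
    by (auto simp: cycles_def)
qed

text \<open>Rank-nullity and exactness below the top give
  \<open>F (Suc k) = Z (Suc k) + Z k\<close>, so the alternating sum of the face numbers telescopes
  to the top term \<open>Z N\<close> up to sign.\<close>

lemma dim_cycles_top:
  assumes van: "\<And>i. i < complex_dim \<Delta> \<Longrightarrow> reduced_homology_vanishes TYPE('k::field) \<Delta> i"
  shows "int (fs.dim (cycles \<Delta> (complex_dim \<Delta>) :: ('a list \<Rightarrow> 'k) set)) = \<bar>\<Sum>\<sigma>\<in>\<Delta>. (- 1) ^ card \<sigma>\<bar>"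
proof -
  \<comment> \<open>Indexing is by number of vertices: \<open>k\<close> stands for the homological
    degree \<open>k - 1\<close>, and \<open>F 0\<close> counts the empty face.\<close>
  define F where "F k = card {\<sigma> \<in> \<Delta>. card \<sigma> = k}" for k
  define Z where "Z k = fs.dim (cycles \<Delta> (int k - 1) :: ('a list \<Rightarrow> 'k) set)" for k
  define N where "N = nat (complex_dim \<Delta> + 1)"
  have N: "int N = complex_dim \<Delta> + 1" using card_le_complex_dim[OF empty_face] by (simp add: N_def)
  have dimC: "fs.dim (oriented_chains \<Delta> (int k - 1) :: ('a list \<Rightarrow> 'k) set) = F k" for k
    using dim_oriented_chains(1)[OF finite_complex finite_face, where i = "int k - 1" and 'k = 'k]
    by (simp add: F_def)
  \<comment> \<open>A chain in degree -1 is supported on the empty list, so it is a cycle; this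
    starts the recursion.\<close>
  have "cycles \<Delta> (- 1) = (oriented_chains \<Delta> (- 1) :: ('a list \<Rightarrow> 'k) set)"
  proof -
    have "boundary_map \<Delta> c = (\<lambda>w. 0)" if "c \<in> oriented_chains \<Delta> (- 1)" for c :: "'a list \<Rightarrow> 'k"
    proof -
      have "c (v # w) = 0" for v w
      proof (rule ccontr)
        assume "c (v # w) \<noteq> 0"
        then have "int (length (v # w)) = 0" using that unfolding oriented_chains_iff by fastforce
        then show False by simp
      qed
      then show ?thesis by (simp add: boundary_map_def)
    qed
    then show ?thesis by (auto simp: cycles_def)
  qed
  then have F0: "F 0 = Z 0" using dimC[of 0] by (simp add: Z_def)
  have FS: "F (Suc k) = Z (Suc k) + Z k" if k: "Suc k \<le> N" for k
  proof -
    let ?C = "oriented_chains \<Delta> (int k) :: ('a list \<Rightarrow> 'k) set"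
    obtain T where T: "finite T" "?C \<subseteq> fs.span T"
      using dim_oriented_chains(2)[OF finite_complex finite_face] by blast
    have "fs.dim ?C = fs.dim {c \<in> ?C. boundary_map \<Delta> c = 0} + fs.dim (boundary_map \<Delta> ` ?C)"
      by (rule fsp.rank_nullity[OF linear_boundary_map subspace_oriented_chains T])
    moreover have "{c \<in> ?C. boundary_map \<Delta> c = 0} = cycles \<Delta> (int k)"
      by (auto simp: cycles_def zero_fun_def)
    moreover have "boundary_map \<Delta> ` ?C = boundaries \<Delta> (int k - 1)"
      by (simp add: boundaries_def)
    moreover have "\<dots> = cycles \<Delta> (int k - 1)"
      using k N by (intro subset_antisym boundaries_subset_cycles reduced_homology_vanishesD van) auto
    ultimately show ?thesis using dimC[of "Suc k"] by (simp add: Z_def)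
  qed
  have alt: "(\<Sum>k\<le>m. (- 1) ^ k * int (F k)) = (- 1) ^ m * int (Z m)" if "m \<le> N" for m
    using that by (induction m) (simp_all add: F0 FS algebra_simps)
  have "(\<Sum>\<sigma>\<in>\<Delta>. (- 1) ^ card \<sigma>) = (\<Sum>k\<le>N. \<Sum>\<sigma>\<in>{\<sigma> \<in> \<Delta>. card \<sigma> = k}. (- 1 :: int) ^ card \<sigma>)"
    using card_le_complex_dim N finite_complex by (intro sum.group[symmetric]) force+
  also have "\<dots> = (\<Sum>k\<le>N. (- 1) ^ k * int (F k))"
    by (intro sum.cong refl) (simp add: F_def)
  also have "\<bar>\<dots>\<bar> = int (Z N)" by (simp add: alt abs_mult power_abs)
  finally show ?thesis by (simp add: Z_def N)
qed

end

section \<open>Strong connectivity of Cohen--Macaulay complexes\<close>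

text \<open>If \<open>a\<close> lies in \<open>S\<close> and \<open>b\<close> does not, the cycle
  \<open>[a] - [b]\<close> is the boundary of some \<open>e\<close>. Its coefficients over
  \<open>S\<close> add up to 1. But no edge of \<open>e\<close> leaves \<open>S\<close>, and the two
  orientations of an edge inside \<open>S\<close> cancel, so the sum is also 0.\<close>

lemma vertices_connected:
  fixes L :: "'a set set"
  assumes fin: "finite (\<Union>L)" and down: "\<And>\<sigma> \<tau>. \<sigma> \<in> L \<Longrightarrow> \<tau> \<subseteq> \<sigma> \<Longrightarrow> \<tau> \<in> L"
    and van: "reduced_homology_vanishes TYPE('k::field) L 0"
    and S: "S \<subseteq> \<Union>L" and a: "a \<in> S" and b: "b \<in> \<Union>L"
    and closed: "\<And>u v. u \<in> S \<Longrightarrow> {u, v} \<in> L \<Longrightarrow> v \<in> S"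
  shows "b \<in> S"
proof (rule ccontr)
  assume nb: "b \<notin> S"
  define c :: "'a list \<Rightarrow> 'k" where "c xs = (if xs = [a] then 1 else if xs = [b] then - 1 else 0)" for xs
  have ab: "{a} \<in> L" "{b} \<in> L" "a \<in> \<Union>L" "a \<noteq> b" using a b S down nb by auto
  have "c \<in> oriented_chains L 0"
    unfolding oriented_chains_def using ab by (auto simp: c_def Cons_eq_append_conv append_eq_Cons_conv)
  moreover have "boundary_map L c = (\<lambda>w. 0)"
  proof
    fix w
    show "boundary_map L c w = 0"
    proof (cases w)
      case Nil
      have "boundary_map L c w = (\<Sum>v\<in>\<Union>L. (if v = a then 1 else 0) + (if v = b then - 1 else 0))"
        unfolding boundary_map_def using Nil ab by (intro sum.cong) (auto simp: c_def)
      also have "\<dots> = 0" unfolding sum.distrib using fin ab b by simp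
      finally show ?thesis .
    qed (simp add: boundary_map_def c_def)
  qed
  ultimately have "c \<in> boundaries L 0"
    using reduced_homology_vanishesD[OF van] by (auto simp: cycles_def)
  then obtain e where e: "e \<in> oriented_chains L 1" "c = boundary_map L e"
    by (auto simp: boundaries_def)
  have alt: "e [u, v] = - e [v, u]" for u v
    using e(1) alternating_swap[of e u v "[]"] by (simp add: oriented_chains_iff)
  \<comment> \<open>Alternation yields only \<open>2 * e [v, v] = 0\<close>, which says nothing in
    characteristic two; the support condition settles it.\<close>
  have diag: "e [v, v] = 0" for v
  proof (rule ccontr)
    assume "e [v, v] \<noteq> 0"
    then have "distinct [v, v]" using e(1) unfolding oriented_chains_iff by blast
    then show False by simp
  qed
  have zero: "(\<Sum>v\<in>V. \<Sum>u\<in>V. e [u, v]) = 0" if "finite V" for V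
    using that
  proof (induction V rule: finite_induct)
    case (insert x V)
    have "(\<Sum>u\<in>V. e [u, x]) = - (\<Sum>v\<in>V. e [x, v])"
      unfolding sum_negf[symmetric] by (rule sum.cong, rule refl, rule alt)
    with insert show ?case by (simp add: sum.distrib diag)
  qed simp
  have finS: "finite S" using S fin finite_subset by auto
  have "(\<Sum>v\<in>S. c [v]) = (\<Sum>v\<in>S. if v = a then 1 else 0)"
    using nb by (intro sum.cong) (auto simp: c_def)
  also have "\<dots> = 1" using a finS by simp
  finally have "1 = (\<Sum>v\<in>S. \<Sum>u\<in>\<Union>L. e [u, v])" by (simp add: e(2) boundary_map_def)
  also have "\<dots> = (\<Sum>v\<in>S. \<Sum>u\<in>S. e [u, v])"
  proof (rule sum.cong[OF refl], rule sum.mono_neutral_right)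
    fix v assume v: "v \<in> S"
    show "\<forall>u\<in>\<Union>L - S. e [u, v] = 0"
    proof (rule ballI, rule ccontr)
      fix u assume u: "u \<in> \<Union>L - S" "e [u, v] \<noteq> 0"
      then have "set [u, v] \<in> L" using e(1) unfolding oriented_chains_iff by blast
      then have "{v, u} \<in> L" by (simp add: insert_commute)
      then show False using closed v u by auto
    qed
  qed (use fin S in auto)
  also have "\<dots> = 0" by (rule zero[OF finS])
  finally show False by simp
qed

section \<open>Links, and facets joined across codimension-one faces\<close>

definition facets :: "'a set set \<Rightarrow> 'a set set" where
  "facets \<Delta> = {F \<in> \<Delta>. \<forall>G\<in>\<Delta>. F \<subseteq> G \<longrightarrow> G = F}"

text \<open>The edge relation of the dual graph of the star of \<open>\<sigma>\<close>; loops occur,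
  as \<open>v = w\<close> is allowed.\<close>

definition facet_flip :: "'a set set \<Rightarrow> 'a set \<Rightarrow> 'a set \<Rightarrow> 'a set \<Rightarrow> bool" where
  "facet_flip \<Delta> \<sigma> F G \<longleftrightarrow> F \<in> facets \<Delta> \<and> G \<in> facets \<Delta> \<and>
    (\<exists>\<tau> v w. \<sigma> \<subseteq> \<tau> \<and> v \<notin> \<tau> \<and> w \<notin> \<tau> \<and> F = insert v \<tau> \<and> G = insert w \<tau>)"

lemma mem_link_iff: "\<tau> \<in> link \<Delta> \<sigma> \<longleftrightarrow> \<tau> \<inter> \<sigma> = {} \<and> \<sigma> \<union> \<tau> \<in> \<Delta>"
proof
  assume "\<tau> \<inter> \<sigma> = {} \<and> \<sigma> \<union> \<tau> \<in> \<Delta>"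
  then have "\<tau> = (\<sigma> \<union> \<tau>) - \<sigma>" "\<sigma> \<union> \<tau> \<in> \<Delta>" by auto
  then show "\<tau> \<in> link \<Delta> \<sigma>" unfolding link_def by blast
next
  assume "\<tau> \<in> link \<Delta> \<sigma>"
  then obtain \<rho> where "\<tau> = \<rho> - \<sigma>" "\<sigma> \<subseteq> \<rho>" "\<rho> \<in> \<Delta>" unfolding link_def by auto
  moreover from this have "\<sigma> \<union> \<tau> = \<rho>" by auto
  ultimately show "\<tau> \<inter> \<sigma> = {} \<and> \<sigma> \<union> \<tau> \<in> \<Delta>" by auto
qed

lemma link_link:
  assumes "\<tau> \<inter> \<sigma> = {}"
  shows "link (link \<Delta> \<sigma>) \<tau> = link \<Delta> (\<sigma> \<union> \<tau>)"
  using assms by (auto simp: mem_link_iff Un_assoc)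

text \<open>A link in a link is again a link in \<open>\<Delta>\<close>, so the vanishing conditions
  are inherited.\<close>

lemma cohen_macaulay_link:
  assumes "cohen_macaulay_complex TYPE('k::field) \<Delta>" "\<sigma> \<in> \<Delta>"
  shows "cohen_macaulay_complex TYPE('k) (link \<Delta> \<sigma>)"
  using assms by (auto simp: cohen_macaulay_complex_def link_link mem_link_iff)

context simplicial_complex
begin

lemma simplicial_complex_link:
  assumes "\<sigma> \<in> \<Delta>" shows "simplicial_complex (link \<Delta> \<sigma>)"
proof
  have "link \<Delta> \<sigma> \<subseteq> (\<lambda>\<tau>. \<tau> - \<sigma>) ` \<Delta>" by (auto simp: link_def)
  then show "finite (link \<Delta> \<sigma>)" using finite_complex finite_subset by blast
  show "finite \<tau>" if "\<tau> \<in> link \<Delta> \<sigma>" for \<tau>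
    using that finite_face by (auto simp: mem_link_iff)
  show "\<rho> \<in> link \<Delta> \<sigma>" if "\<tau> \<in> link \<Delta> \<sigma>" "\<rho> \<subseteq> \<tau>" for \<rho> \<tau>
    using that down_closed[of "\<sigma> \<union> \<tau>" "\<sigma> \<union> \<rho>"] by (auto simp: mem_link_iff)
  show "{} \<in> link \<Delta> \<sigma>" using assms by (simp add: mem_link_iff)
qed

lemma facet_containing:
  assumes "\<sigma> \<in> \<Delta>"
  obtains F where "F \<in> facets \<Delta>" "\<sigma> \<subseteq> F"
proof -
  obtain F where "F \<in> \<Delta>" "\<sigma> \<subseteq> F" "\<And>G. G \<in> \<Delta> \<Longrightarrow> F \<subseteq> G \<Longrightarrow> F = G"
    using finite_has_maximal2[OF finite_complex assms] by metis
  then show ?thesis by (intro that[of F]) (auto simp: facets_def)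
qed

text \<open>Induction on the number of vertices outside \<open>\<sigma>\<close>. Facets that share a
  further vertex \<open>u\<close> are joined by the induction hypothesis for
  \<open>insert u \<sigma>\<close>. If the link of \<open>\<sigma>\<close> has positive dimension,
  its vertices are connected through edges because its homology vanishes in degree 0, and this joins
  facets with different further vertices.\<close>

lemma strongly_connected_star:
  assumes cm: "cohen_macaulay_complex TYPE('k::field) \<Delta>"
    and "\<sigma> \<in> \<Delta>" "F \<in> facets \<Delta>" "G \<in> facets \<Delta>" "\<sigma> \<subseteq> F" "\<sigma> \<subseteq> G"
  shows "(facet_flip \<Delta> \<sigma>)\<^sup>*\<^sup>* F G"
  using assms(2-)
proof (induction "card (\<Union>\<Delta> - \<sigma>)" arbitrary: \<sigma> F G rule: less_induct)
  case (less \<sigma> F G)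
  let ?L = "link \<Delta> \<sigma>"
  interpret L: simplicial_complex ?L by (rule simplicial_complex_link[OF less.prems(1)])
  have FL: "F - \<sigma> \<in> ?L" "G - \<sigma> \<in> ?L"
    using less.prems by (auto simp: link_def facets_def)
  show ?case
  proof (cases "complex_dim ?L \<ge> 1")
    \<comment> \<open>Every facet through \<open>\<sigma>\<close> has at most one further vertex
      here, so two of them are equal or adjacent across \<open>\<sigma>\<close> itself.\<close>
    case False
    have one: "card (H - \<sigma>) \<le> 1" if "H - \<sigma> \<in> ?L" for H
      using L.card_le_complex_dim[OF that] False by linarith
    show ?thesis
    proof (cases "F = \<sigma> \<or> G = \<sigma>")
      case True
      then have "F = G" using less.prems by (auto simp: facets_def)
      then show ?thesis by simp
    next
      case False
      have "\<exists>v. H = insert v \<sigma> \<and> v \<notin> \<sigma>" if "H - \<sigma> \<in> ?L" "\<sigma> \<subseteq> H" "H \<noteq> \<sigma>" for H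
      proof -
        have "finite (H - \<sigma>)" "H - \<sigma> \<noteq> {}" using that L.finite_face by auto
        then have "card (H - \<sigma>) = 1"
          using one[OF that(1)] by (metis One_nat_def Suc_leI card_gt_0_iff le_antisym)
        then obtain v where "H - \<sigma> = {v}" by (auto simp: card_1_singleton_iff)
        then show ?thesis using that by (intro exI[of _ v]) auto
      qed
      then obtain v w where "F = insert v \<sigma>" "v \<notin> \<sigma>" "G = insert w \<sigma>" "w \<notin> \<sigma>"
        using FL less.prems False by metis
      then have "facet_flip \<Delta> \<sigma> F G" unfolding facet_flip_def using less.prems by blast
      then show ?thesis by auto
    qed
  next
    case True
    have IH: "(facet_flip \<Delta> \<sigma>)\<^sup>*\<^sup>* H K"
      if u: "{u} \<in> ?L" and H: "H \<in> facets \<Delta>" "insert u \<sigma> \<subseteq> H" and K: "K \<in> facets \<Delta>" "insert u \<sigma> \<subseteq> K"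
      for u H K
    proof -
      have u': "insert u \<sigma> \<in> \<Delta>" "u \<notin> \<sigma>" using u by (auto simp: mem_link_iff)
      have "\<Union>\<Delta> - insert u \<sigma> \<subset> \<Union>\<Delta> - \<sigma>" using u' by auto
      then have "card (\<Union>\<Delta> - insert u \<sigma>) < card (\<Union>\<Delta> - \<sigma>)"
        by (rule psubset_card_mono[rotated]) (simp add: finite_vertices)
      then have "(facet_flip \<Delta> (insert u \<sigma>))\<^sup>*\<^sup>* H K"
        using less.hyps[of "insert u \<sigma>"] u' H K by blast
      moreover have "facet_flip \<Delta> (insert u \<sigma>) A B \<longrightarrow> facet_flip \<Delta> \<sigma> A B" for A B
        unfolding facet_flip_def insert_subset by metis
      ultimately show ?thesis
        using mono_rtranclp[of "facet_flip \<Delta> (insert u \<sigma>)" "facet_flip \<Delta> \<sigma>" H K] by blast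
    qed
    obtain \<tau> where \<tau>: "\<tau> \<in> ?L" "int (card \<tau>) = complex_dim ?L + 1" by (rule L.complex_dim_face)
    then have "\<tau> \<noteq> {}" using True by auto
    moreover have "\<tau> \<inter> \<sigma> = {}" "\<sigma> \<union> \<tau> \<in> \<Delta>" using \<tau>(1) by (auto simp: mem_link_iff)
    ultimately have "\<sigma> \<notin> facets \<Delta>" unfolding facets_def by blast
    then have "F \<noteq> \<sigma>" "G \<noteq> \<sigma>" using less.prems by auto
    then obtain v w where v: "v \<in> F" "v \<notin> \<sigma>" and w: "w \<in> G" "w \<notin> \<sigma>" using less.prems(4,5) by blast
    have vw: "{v} \<in> ?L" "{w} \<in> ?L" using v w FL L.down_closed by blast+
    \<comment> \<open>The vertices of the link that lie in a facet reachable from \<open>F\<close>.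
      For an edge \<open>{a, b}\<close> of the link, a facet through both is reachable from any
      facet through \<open>a\<close>, so the set is closed.\<close>
    let ?S = "{u \<in> \<Union>?L. \<exists>H\<in>facets \<Delta>. insert u \<sigma> \<subseteq> H \<and> (facet_flip \<Delta> \<sigma>)\<^sup>*\<^sup>* F H}"
    have "w \<in> ?S"
    proof (rule vertices_connected[of ?L])
      show "reduced_homology_vanishes TYPE('k) ?L 0"
        using cm less.prems(1) True by (auto simp: cohen_macaulay_complex_def)
      show "v \<in> ?S" using v vw less.prems by auto
      show "w \<in> \<Union>?L" using vw by auto
      fix a b assume a: "a \<in> ?S" and ab: "{a, b} \<in> ?L"
      then obtain H where H: "H \<in> facets \<Delta>" "insert a \<sigma> \<subseteq> H" "(facet_flip \<Delta> \<sigma>)\<^sup>*\<^sup>* F H" by auto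
      have "\<sigma> \<union> {a, b} \<in> \<Delta>" using ab unfolding mem_link_iff by blast
      then obtain K where K: "K \<in> facets \<Delta>" "\<sigma> \<union> {a, b} \<subseteq> K" by (rule facet_containing)
      have "{a} \<in> ?L" using ab L.down_closed by blast
      from IH[OF this H(1,2) K(1)] K(2) H(3) have "(facet_flip \<Delta> \<sigma>)\<^sup>*\<^sup>* F K" by auto
      then show "b \<in> ?S" using K ab by auto
    qed (use L.finite_vertices L.down_closed in auto)
    then obtain H where H: "H \<in> facets \<Delta>" "insert w \<sigma> \<subseteq> H" "(facet_flip \<Delta> \<sigma>)\<^sup>*\<^sup>* F H" by auto
    from IH[OF vw(2) H(1,2), of G] w less.prems H(3) show ?thesis by auto
  qed
qed

text \<open>Flips preserve the number of vertices, and every facet is joined by flips to one that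
  contains a face of top dimension.\<close>

lemma card_facet:
  assumes cm: "cohen_macaulay_complex TYPE('k::field) \<Delta>" and F: "F \<in> facets \<Delta>"
  shows "int (card F) = complex_dim \<Delta> + 1"
proof -
  obtain \<tau> where \<tau>: "\<tau> \<in> \<Delta>" "int (card \<tau>) = complex_dim \<Delta> + 1" by (rule complex_dim_face)
  obtain G where G: "G \<in> facets \<Delta>" "\<tau> \<subseteq> G" using facet_containing[OF \<tau>(1)] .
  then have "card \<tau> \<le> card G" using finite_face by (intro card_mono) (auto simp: facets_def)
  then have cG: "int (card G) = complex_dim \<Delta> + 1"
    using \<tau> card_le_complex_dim[of G] G by (auto simp: facets_def)
  have "(facet_flip \<Delta> {})\<^sup>*\<^sup>* F G"
    using strongly_connected_star[OF cm empty_face F G(1)] by auto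
  then have "card F = card G"
  proof induction
    case (step H K)
    then obtain \<tau> v w where "v \<notin> \<tau>" "w \<notin> \<tau>" "H = insert v \<tau>" "K = insert w \<tau>" "H \<in> \<Delta>"
      by (auto simp: facet_flip_def facets_def)
    then show ?case using step.IH finite_face[of H] by simp
  qed simp
  then show ?thesis using cG by simp
qed

text \<open>Purity gives the lower bound: a facet through \<open>x\<close> has top dimension, and
  removing \<open>x\<close> costs exactly one.\<close>

lemma complex_dim_link_vertex:
  assumes cm: "cohen_macaulay_complex TYPE('k::field) \<Delta>" and x: "{x} \<in> \<Delta>"
  shows "complex_dim (link \<Delta> {x}) = complex_dim \<Delta> - 1"
proof (rule antisym)
  interpret L: simplicial_complex "link \<Delta> {x}" by (rule simplicial_complex_link[OF x])
  obtain \<tau> where \<tau>: "\<tau> \<in> link \<Delta> {x}" "int (card \<tau>) = complex_dim (link \<Delta> {x}) + 1"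
    by (rule L.complex_dim_face)
  then show "complex_dim (link \<Delta> {x}) \<le> complex_dim \<Delta> - 1"
    using card_le_complex_dim[of "insert x \<tau>"] L.finite_face[of \<tau>] by (simp add: mem_link_iff)
  obtain F where F: "F \<in> facets \<Delta>" "{x} \<subseteq> F" using facet_containing[OF x] .
  then have "F - {x} \<in> link \<Delta> {x}" by (auto simp: facets_def link_def)
  from L.card_le_complex_dim[OF this] card_facet[OF cm F(1)] F finite_face[of F]
  show "complex_dim \<Delta> - 1 \<le> complex_dim (link \<Delta> {x})"
    by (auto simp: facets_def card_Diff_singleton_if)
qed

text \<open>Fixing \<open>x\<close> as first entry extracts the part of \<open>c\<close> through
  \<open>x\<close>. Its boundary at \<open>w\<close> is minus the boundary of \<open>c\<close> at
  \<open>x # w\<close>; vertices outside the link contribute zero.\<close>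

lemma cycle_link_vertex:
  fixes c :: "'a list \<Rightarrow> 'k::field"
  assumes c: "c \<in> cycles \<Delta> i"
  shows "(\<lambda>w. c (x # w)) \<in> cycles (link \<Delta> {x}) (i - 1)"
proof -
  have alt: "alternating c" and supp: "\<And>xs. c xs \<noteq> 0 \<Longrightarrow> distinct xs \<and> set xs \<in> \<Delta> \<and> int (length xs) = i + 1"
    and bd: "\<And>w. (\<Sum>v\<in>\<Union>\<Delta>. c (v # w)) = 0"
    using c by (auto simp: cycles_def oriented_chains_iff boundary_map_def fun_eq_iff)
  have "(\<lambda>w. c (x # w)) \<in> oriented_chains (link \<Delta> {x}) (i - 1)"
    unfolding oriented_chains_iff using alternating_Cons[OF alt] supp by (force simp: mem_link_iff)
  moreover have "boundary_map (link \<Delta> {x}) (\<lambda>w. c (x # w)) w = 0" for w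
  proof -
    have "boundary_map (link \<Delta> {x}) (\<lambda>w. c (x # w)) w = (\<Sum>v\<in>\<Union>\<Delta>. c (x # v # w))"
      unfolding boundary_map_def
    proof (rule sum.mono_neutral_left[OF finite_vertices])
      show "\<Union> (link \<Delta> {x}) \<subseteq> \<Union>\<Delta>" by (auto simp: link_def)
      show "\<forall>v\<in>\<Union>\<Delta> - \<Union> (link \<Delta> {x}). c (x # v # w) = 0"
      proof (rule ballI, rule ccontr)
        fix v assume v: "v \<in> \<Union>\<Delta> - \<Union> (link \<Delta> {x})" "c (x # v # w) \<noteq> 0"
        from supp[OF v(2)] have "insert v (set w) \<in> link \<Delta> {x}"
          by (auto simp: mem_link_iff insert_commute)
        then show False using v by auto
      qed
    qed
    also have "\<dots> = - (\<Sum>v\<in>\<Union>\<Delta>. c (v # x # w))"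
      unfolding sum_negf[symmetric] by (rule sum.cong[OF refl], rule alternating_swap[OF alt])
    finally show ?thesis using bd by simp
  qed
  ultimately show ?thesis by (auto simp: cycles_def)
qed

end

section \<open>Order complexes and the Moebius function\<close>

locale finite_poset =
  fixes P :: "'a set" and r :: "'a rel"
  assumes finite_carrier: "finite P" and partial_order: "partial_order_on P r"
begin

lemma le_refl: "x \<in> P \<Longrightarrow> (x, x) \<in> r"
  using partial_order_onD(1)[OF partial_order] by (simp add: refl_on_def)

lemma le_trans: "(x, y) \<in> r \<Longrightarrow> (y, w) \<in> r \<Longrightarrow> (x, w) \<in> r"
  using partial_order_onD(2)[OF partial_order] by (rule transD)

lemma le_antisym: "(x, y) \<in> r \<Longrightarrow> (y, x) \<in> r \<Longrightarrow> x = y"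
  using partial_order_onD(3)[OF partial_order] by (rule antisymD)

lemma le_carrier: "(x, y) \<in> r \<Longrightarrow> x \<in> P \<and> y \<in> P"
  using partial_order_onD(4)[OF partial_order] by auto

lemma order_complex_iff:
  "C \<in> order_complex A r \<longleftrightarrow> C \<subseteq> A \<and> (\<forall>a\<in>C. \<forall>b\<in>C. (a, b) \<in> r \<or> (b, a) \<in> r)"
  by (auto simp: order_complex_def Chains_def)

lemma insert_order_complex:
  assumes "C \<in> order_complex A r" "t \<in> A" "t \<in> P" "\<And>c. c \<in> C \<Longrightarrow> (c, t) \<in> r \<or> (t, c) \<in> r"
  shows "insert t C \<in> order_complex A r"
  using assms by (auto simp: order_complex_iff le_refl)

lemma chain_max:
  assumes "finite C" "C \<noteq> {}" "C \<in> order_complex A r"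
  obtains t where "t \<in> C" "\<And>c. c \<in> C \<Longrightarrow> (c, t) \<in> r"
proof -
  have "\<exists>t\<in>C. \<forall>c\<in>C. (c, t) \<in> r"
    using assms
  proof (induction C rule: finite_ne_induct)
    case (singleton x)
    then show ?case by (auto simp: order_complex_iff)
  next
    case (insert x C)
    then obtain t where t: "t \<in> C" "\<forall>c\<in>C. (c, t) \<in> r" by (auto simp: order_complex_iff)
    have "(t, x) \<in> r \<or> (x, t) \<in> r" "(x, x) \<in> r" using insert.prems t(1) by (auto simp: order_complex_iff)
    with t show ?case by (blast intro: le_trans)
  qed
  then show ?thesis using that by blast
qed

lemma chain_min:
  assumes "finite C" "C \<noteq> {}" "C \<in> order_complex A r"
  obtains t where "t \<in> C" "\<And>c. c \<in> C \<Longrightarrow> (t, c) \<in> r"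
proof -
  interpret c: finite_poset P "r\<inverse>"
    by unfold_locales (simp_all add: finite_carrier partial_order)
  have "C \<in> order_complex A (r\<inverse>)" using assms(3) by (auto simp: order_complex_def Chains_def)
  from c.chain_max[OF assms(1,2) this] that show ?thesis by auto
qed

lemma simplicial_complex_order_complex:
  assumes "A \<subseteq> P" shows "simplicial_complex (order_complex A r)"
proof
  have fin: "finite A" using assms finite_carrier finite_subset by blast
  have "order_complex A r \<subseteq> Pow A" by (auto simp: order_complex_iff)
  then show "finite (order_complex A r)" using fin finite_subset by auto
  show "finite \<sigma>" if "\<sigma> \<in> order_complex A r" for \<sigma>
    using that fin finite_subset by (auto simp: order_complex_iff)
qed (auto simp: order_complex_iff)

text \<open>A chain of \<open>k\<close> elements is a simplex of dimension \<open>k - 1\<close>, so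
  this is minus the reduced Euler characteristic.\<close>

definition chi :: "'a set \<Rightarrow> int" where
  "chi A = (\<Sum>C\<in>order_complex A r. (- 1) ^ card C)"

text \<open>Nonempty chains are sorted by their greatest element \<open>t\<close>; removing it
  leaves a chain strictly below \<open>t\<close> and changes the sign. The summand 1 is the empty
  chain.\<close>

lemma chi_recursion:
  assumes A: "A \<subseteq> P"
  shows "chi A = 1 - (\<Sum>t\<in>A. chi {a \<in> A. (a, t) \<in> r \<and> a \<noteq> t})"
proof -
  interpret simplicial_complex "order_complex A r" by (rule simplicial_complex_order_complex[OF A])
  let ?L = "\<lambda>t. {a \<in> A. (a, t) \<in> r \<and> a \<noteq> t}"
  let ?O = "\<lambda>t. order_complex (?L t) r"
  have finA: "finite A" using A finite_carrier finite_subset by blast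
  have finO: "finite (?O t)" for t
    using simplicial_complex.finite_complex[OF simplicial_complex_order_complex, of "?L t"] A by auto
  have mem: "finite C" "t \<notin> C" "C \<subseteq> ?L t" if "C \<in> ?O t" for C t
    using that finA finite_subset[of C A] by (auto simp: order_complex_iff)
  have top: "t = u" if "insert t C = insert u D" "C \<in> ?O t" "D \<in> ?O u" for t u C D
  proof (rule ccontr)
    assume "t \<noteq> u"
    then have "t \<in> D" "u \<in> C" using that(1) by auto
    then have "(t, u) \<in> r" "(u, t) \<in> r" using mem(3) that(2,3) by auto
    then show False using le_antisym \<open>t \<noteq> u\<close> by blast
  qed
  have inj: "inj_on (\<lambda>(t, C). insert t C) (Sigma A ?O)"
  proof (rule inj_onI, clarify)
    fix t C u D assume *: "C \<in> ?O t" "D \<in> ?O u" "insert t C = insert u D"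
    then have "t = u" using top by blast
    then show "t = u \<and> C = D" using * mem(2)[of C t] mem(2)[of D u] by (metis insert_ident)
  qed
  have img: "(\<lambda>(t, C). insert t C) ` Sigma A ?O = order_complex A r - {{}}"
  proof (intro subset_antisym subsetI)
    fix B assume "B \<in> (\<lambda>(t, C). insert t C) ` Sigma A ?O"
    then obtain t C where "t \<in> A" "C \<in> ?O t" "B = insert t C" by auto
    then show "B \<in> order_complex A r - {{}}"
      using A by (auto simp: order_complex_iff intro: le_refl)
  next
    fix B assume B: "B \<in> order_complex A r - {{}}"
    then have "finite B" using finite_face by auto
    then obtain t where t: "t \<in> B" "\<And>c. c \<in> B \<Longrightarrow> (c, t) \<in> r" using chain_max B by blast
    then have "B - {t} \<in> ?O t" "t \<in> A" "B = insert t (B - {t})" using B by (auto simp: order_complex_iff)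
    then show "B \<in> (\<lambda>(t, C). insert t C) ` Sigma A ?O" by (intro image_eqI[of _ _ "(t, B - {t})"]) auto
  qed
  have "chi A = 1 + (\<Sum>C\<in>order_complex A r - {{}}. (- 1) ^ card C)"
    unfolding chi_def using finite_complex empty_face by (subst sum.remove[of _ "{}"]) auto
  also have "(\<Sum>C\<in>order_complex A r - {{}}. (- 1 :: int) ^ card C)
      = (\<Sum>(t, C)\<in>Sigma A ?O. (- 1) ^ card (insert t C))"
    unfolding img[symmetric] sum.reindex[OF inj] by (simp add: case_prod_unfold)
  also have "\<dots> = (\<Sum>t\<in>A. \<Sum>C\<in>?O t. (- 1) ^ card (insert t C))"
    using finA finO by (intro sum.Sigma[symmetric]) auto
  also have "\<dots> = (\<Sum>t\<in>A. - chi (?L t))"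
    unfolding chi_def sum_negf[symmetric] using mem by (intro sum.cong refl) auto
  finally show ?thesis by (simp add: sum_negf)
qed

text \<open>Hall's theorem: the part of an open interval below \<open>w\<close> is again an open
  interval, so \<open>chi_recursion\<close> is the recursion of the Moebius function with reversed
  sign.\<close>

lemma mobius_eq_chi:
  assumes "(x, y) \<in> r" "x \<noteq> y"
  shows "mobius P r x y = - chi {w \<in> P. (x, w) \<in> r \<and> w \<noteq> x \<and> (w, y) \<in> r \<and> w \<noteq> y}"
  using assms
proof (induction "card (interval P r x y)" arbitrary: y rule: less_induct)
  case less
  let ?A = "\<lambda>y. {w \<in> P. (x, w) \<in> r \<and> w \<noteq> x \<and> (w, y) \<in> r \<and> w \<noteq> y}"
  have x: "x \<in> P" "y \<in> P" using le_carrier less.prems by auto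
  have fin: "finite (?A y)" using finite_carrier by auto
  have split: "interval P r x y - {y} = insert x (?A y)"
    using less.prems x le_refl by (auto simp: interval_def)
  have "mobius P r x y = - (\<Sum>w\<in>interval P r x y - {y}. mobius P r x w)"
    using less.prems by (subst mobius.simps) (simp add: finite_carrier partial_order)
  also have "\<dots> = - (mobius P r x x + (\<Sum>w\<in>?A y. mobius P r x w))"
    unfolding split using fin by (subst sum.insert) auto
  also have "mobius P r x x = 1"
    using x le_refl by (subst mobius.simps) (simp add: finite_carrier partial_order)
  also have "(\<Sum>w\<in>?A y. mobius P r x w) = (\<Sum>w\<in>?A y. - chi {a \<in> ?A y. (a, w) \<in> r \<and> a \<noteq> w})"
  proof (rule sum.cong[OF refl])
    fix w assume w: "w \<in> ?A y"
    have "interval P r x w \<subset> interval P r x y"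
      using w x less.prems by (auto simp: interval_def intro: le_trans le_refl dest: le_antisym)
    then have "card (interval P r x w) < card (interval P r x y)"
      using finite_carrier by (intro psubset_card_mono) (auto simp: interval_def)
    then have "mobius P r x w = - chi (?A w)" using less.hyps w by auto
    also have "?A w = {a \<in> ?A y. (a, w) \<in> r \<and> a \<noteq> w}"
      using w by (auto intro: le_trans dest: le_antisym)
    finally show "mobius P r x w = - chi {a \<in> ?A y. (a, w) \<in> r \<and> a \<noteq> w}" .
  qed
  also have "- (1 + \<dots>) = - chi (?A y)"
    by (subst chi_recursion[of "?A y"]) (auto simp: sum_negf)
  finally show ?case .
qed

lemma finite_poset_hat: "finite_poset (hat_carrier P) (hat_rel P r)"
proof
  show "finite (hat_carrier P)" by (simp add: hat_carrier_def finite_carrier)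
qed (rule partial_order_on_hat[OF partial_order])

text \<open>The open interval from \<open>Some x\<close> to \<open>None\<close> is a copy of the
  elements strictly above \<open>x\<close>.\<close>

lemma mobius_hat:
  assumes "x \<in> P"
  shows "mobius (hat_carrier P) (hat_rel P r) (Some x) None = - chi {w \<in> P. (x, w) \<in> r \<and> w \<noteq> x}"
proof -
  interpret h: finite_poset "hat_carrier P" "hat_rel P r" by (rule finite_poset_hat)
  let ?B = "{w \<in> hat_carrier P. (Some x, w) \<in> hat_rel P r \<and> w \<noteq> Some x \<and> (w, None) \<in> hat_rel P r \<and> w \<noteq> None}"
  let ?A = "{w \<in> P. (x, w) \<in> r \<and> w \<noteq> x}"
  have hat: "(Some a, Some b) \<in> hat_rel P r \<longleftrightarrow> (a, b) \<in> r" for a b by (auto simp: hat_rel_def)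
  have B: "?B = Some ` ?A" by (auto simp: hat_carrier_def hat_rel_def)
  have image: "Some ` D \<in> order_complex (Some ` ?A) (hat_rel P r) \<longleftrightarrow> D \<in> order_complex ?A r" for D
    by (simp add: h.order_complex_iff order_complex_iff hat inj_image_subset_iff)
  have "order_complex (Some ` ?A) (hat_rel P r) = (`) Some ` order_complex ?A r"
  proof (intro subset_antisym subsetI)
    fix C assume C: "C \<in> order_complex (Some ` ?A) (hat_rel P r)"
    then obtain D where "C = Some ` D" by (auto simp: h.order_complex_iff subset_image_iff)
    then show "C \<in> (`) Some ` order_complex ?A r" using C image by blast
  qed (use image in blast)
  moreover have "inj_on ((`) Some) (order_complex ?A r)" by (auto intro!: inj_onI simp: inj_image_eq_iff)
  ultimately have "h.chi (Some ` ?A) = chi ?A"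
    unfolding h.chi_def chi_def by (simp add: sum.reindex card_image)
  moreover have "(Some x, None) \<in> hat_rel P r" using assms by (auto simp: hat_rel_def hat_carrier_def)
  ultimately show ?thesis using h.mobius_eq_chi[of "Some x" None] unfolding B by simp
qed

lemma link_order_complex_vertex:
  assumes "x \<in> A" "A \<subseteq> P"
  shows "link (order_complex A r) {x} = order_complex {w \<in> A. w \<noteq> x \<and> ((x, w) \<in> r \<or> (w, x) \<in> r)} r"
  using assms le_refl by (fastforce simp: mem_link_iff order_complex_iff)

end

section \<open>The diamond property and the inequality\<close>

text \<open>The neighbours \<open>a\<close> and \<open>b\<close> of \<open>v\<close> in the chain
  bound an interval of rank two, whose inner elements are exactly those that complete
  \<open>\<tau>\<close>. Each of them has Moebius value -1 from \<open>a\<close>, so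
  \<open>mobius P r a b = 1\<close> forces two of them.\<close>

lemma (in finite_poset) diamond:
  assumes eul: "\<And>x y. (x, y) \<in> r \<Longrightarrow> graded (interval P r x y) r \<and> mobius P r x y = (- 1) ^ rho P r x y"
    and F: "insert v \<tau> \<in> facets (order_complex P r)" and v: "v \<notin> \<tau>"
    and below: "s \<in> \<tau>" "(s, v) \<in> r" and above: "t \<in> \<tau>" "(v, t) \<in> r"
  shows "card {u \<in> P - \<tau>. insert u \<tau> \<in> order_complex P r} = 2"
proof -
  have ch: "insert v \<tau> \<in> order_complex P r" using F by (simp add: facets_def)
  then have vP: "v \<in> P" and tauP: "\<tau> \<subseteq> P"
    and comp: "\<And>a b. a \<in> insert v \<tau> \<Longrightarrow> b \<in> insert v \<tau> \<Longrightarrow> (a, b) \<in> r \<or> (b, a) \<in> r"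
    by (auto simp: order_complex_iff)
  have max: "u \<in> insert v \<tau>"
    if "u \<in> P" "\<And>c. c \<in> insert v \<tau> \<Longrightarrow> (c, u) \<in> r \<or> (u, c) \<in> r" for u
  proof -
    have "insert u (insert v \<tau>) \<in> order_complex P r" using insert_order_complex[OF ch] that by blast
    then show ?thesis using F unfolding facets_def by blast
  qed
  have fin: "finite \<tau>" using tauP finite_carrier finite_subset by blast
  have sub: "D \<in> order_complex P r" if "D \<subseteq> insert v \<tau>" for D
    using ch that unfolding order_complex_iff by blast
  obtain a where a: "a \<in> \<tau>" "(a, v) \<in> r" and a_max: "\<And>c. c \<in> \<tau> \<Longrightarrow> (c, v) \<in> r \<Longrightarrow> (c, a) \<in> r"
  proof -
    have "{c \<in> \<tau>. (c, v) \<in> r} \<in> order_complex P r" by (intro sub) auto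
    then obtain a where "a \<in> {c \<in> \<tau>. (c, v) \<in> r}" "\<And>c. c \<in> {c \<in> \<tau>. (c, v) \<in> r} \<Longrightarrow> (c, a) \<in> r"
      by (rule chain_max[rotated 2]) (use fin below in auto)
    then show ?thesis by (intro that[of a]) auto
  qed
  obtain b where b: "b \<in> \<tau>" "(v, b) \<in> r" and b_min: "\<And>c. c \<in> \<tau> \<Longrightarrow> (v, c) \<in> r \<Longrightarrow> (b, c) \<in> r"
  proof -
    have "{c \<in> \<tau>. (v, c) \<in> r} \<in> order_complex P r" by (intro sub) auto
    then obtain b where "b \<in> {c \<in> \<tau>. (v, c) \<in> r}" "\<And>c. c \<in> {c \<in> \<tau>. (v, c) \<in> r} \<Longrightarrow> (b, c) \<in> r"
      by (rule chain_min[rotated 2]) (use fin above in auto)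
    then show ?thesis by (intro that[of b]) auto
  qed
  have neq: "a \<noteq> v" "b \<noteq> v" "a \<noteq> b" using a b v le_antisym by auto
  have ab: "(a, b) \<in> r" using a b le_trans by blast
  have aP: "a \<in> P" "b \<in> P" using a b tauP by auto
  have sides: "(c, a) \<in> r \<or> (b, c) \<in> r" if "c \<in> \<tau>" for c
    using a_max[OF that] b_min[OF that] comp[of c v] that by auto
  let ?M = "interval P r a b - {a, b}"
  \<comment> \<open>If \<open>u\<close> is comparable to all of \<open>\<tau>\<close> but not above
    \<open>a\<close>, it lies below \<open>a\<close> and hence below \<open>v\<close>. Maximality of
    the facet then makes it \<open>v\<close>, which is above \<open>a\<close>. The bound
    \<open>b\<close> is dual.\<close>
  have open_interval: "{u \<in> P - \<tau>. insert u \<tau> \<in> order_complex P r} = ?M"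
  proof (intro subset_antisym subsetI)
    fix u assume "u \<in> {u \<in> P - \<tau>. insert u \<tau> \<in> order_complex P r}"
    then have u: "u \<in> P" "u \<notin> \<tau>" "\<And>c. c \<in> \<tau> \<Longrightarrow> (c, u) \<in> r \<or> (u, c) \<in> r"
      by (auto simp: order_complex_iff)
    have "(a, u) \<in> r"
    proof (rule ccontr)
      assume "(a, u) \<notin> r"
      then have "(u, v) \<in> r" using u(3)[OF a(1)] a(2) le_trans by blast
      then have "u = v" using max[of u] u by blast
      then show False using a \<open>(a, u) \<notin> r\<close> by simp
    qed
    moreover have "(u, b) \<in> r"
    proof (rule ccontr)
      assume "(u, b) \<notin> r"
      then have "(v, u) \<in> r" using u(3)[OF b(1)] b(2) le_trans by blast
      then have "u = v" using max[of u] u by blast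
      then show False using b \<open>(u, b) \<notin> r\<close> by simp
    qed
    ultimately show "u \<in> ?M" using u a b by (auto simp: interval_def)
  next
    fix u assume "u \<in> ?M"
    then have u: "u \<in> P" "(a, u) \<in> r" "(u, b) \<in> r" "u \<noteq> a" "u \<noteq> b" by (auto simp: interval_def)
    have "u \<notin> \<tau>"
    proof
      assume "u \<in> \<tau>"
      from sides[OF this] u show False using le_antisym by blast
    qed
    moreover have "(c, u) \<in> r \<or> (u, c) \<in> r" if "c \<in> \<tau>" for c
      using sides[OF that] u le_trans by blast
    moreover have "\<tau> \<in> order_complex P r" by (intro sub) auto
    ultimately show "u \<in> {u \<in> P - \<tau>. insert u \<tau> \<in> order_complex P r}"
      using u(1) insert_order_complex[of \<tau> P u] by auto
  qed
  let ?I = "interval P r a b"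
  have finI: "finite ?I" using finite_carrier by (simp add: interval_def)
  have vI: "v \<in> ?I" "a \<in> ?I" "b \<in> ?I"
    using a b ab aP vP le_refl by (auto simp: interval_def)
  \<comment> \<open>An element of a larger chain in the interval is comparable to the whole facet,
    hence in it, and no element of \<open>\<tau>\<close> lies strictly between \<open>a\<close> and
    \<open>b\<close>.\<close>
  have avb: "{a, v, b} \<in> maximal_chains ?I r"
  proof -
    have "D = {a, v, b}" if D: "D \<in> Chains r" "{a, v, b} \<subseteq> D" "D \<subseteq> ?I" for D
    proof -
      have "d \<in> {a, v, b}" if "d \<in> D" for d
      proof -
        have d: "d \<in> P" "(a, d) \<in> r" "(d, b) \<in> r" "(v, d) \<in> r \<or> (d, v) \<in> r"
          using D that by (auto simp: interval_def Chains_def)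
        have "(c, d) \<in> r \<or> (d, c) \<in> r" if "c \<in> insert v \<tau>" for c
          using that sides[of c] d le_trans by blast
        then have "d \<in> insert v \<tau>" using max d by blast
        then show ?thesis using sides[of d] d le_antisym by blast
      qed
      then show ?thesis using D by auto
    qed
    moreover have "{a, v, b} \<in> Chains r"
      using sub[of "{a, v, b}"] a(1) b(1) by (simp add: order_complex_def)
    ultimately show ?thesis using vI unfolding maximal_chains_def by blast
  qed
  have three: "card {a, u, b} = 3" if "u \<in> ?M" for u using that neq by auto
  obtain n where n: "\<And>C. C \<in> maximal_chains ?I r \<Longrightarrow> card C - 1 = n"
    using eul[OF ab] by (auto simp: graded_def)
  have "n = 2" using n[OF avb] three[of v] vI neq by auto
  have "rho P r a b = 2"
    unfolding rho_def using n avb \<open>n = 2\<close> by (intro the_equality) auto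
  then have mu: "mobius P r a b = 1" using eul[OF ab] by simp
  have atom: "mobius P r a u = - 1" if u: "u \<in> ?M" for u
  proof -
    have u': "u \<in> P" "(a, u) \<in> r" "(u, b) \<in> r" "u \<noteq> a" "u \<noteq> b" using u by (auto simp: interval_def)
    have "w \<in> {a, u}" if w: "w \<in> interval P r a u" for w
    proof -
      have w': "w \<in> P" "(a, w) \<in> r" "(w, u) \<in> r" using w by (auto simp: interval_def)
      \<comment> \<open>A maximal chain containing \<open>?W\<close> has three elements by
        gradedness, so it is \<open>{a, u, b}\<close> and \<open>w\<close> is not new.\<close>
      let ?W = "{a, w, u, b}"
      have "?W \<in> Chains r" "?W \<subseteq> ?I"
        using w' u' ab aP le_refl le_trans[OF w'(3) u'(3)] by (auto simp: Chains_def interval_def)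
      then have "?W \<in> {D \<in> Chains r. D \<subseteq> ?I}" by simp
      moreover have "finite {D \<in> Chains r. D \<subseteq> ?I}"
        by (rule finite_subset[of _ "Pow ?I"]) (use finI in auto)
      ultimately obtain E where E: "E \<in> Chains r" "E \<subseteq> ?I" "?W \<subseteq> E"
        and E_max: "\<And>D. D \<in> Chains r \<Longrightarrow> D \<subseteq> ?I \<Longrightarrow> E \<subseteq> D \<Longrightarrow> E = D"
        using finite_has_maximal2[of "{D \<in> Chains r. D \<subseteq> ?I}" ?W] by auto
      then have "E \<in> maximal_chains ?I r" unfolding maximal_chains_def by blast
      then have "card E = 3" using n[of E] \<open>n = 2\<close> by simp
      moreover have "finite E" using E finI finite_subset by blast
      ultimately have "{a, u, b} = E" using E three[OF u] by (intro card_subset_eq) auto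
      then have "w \<in> {a, u, b}" using E by auto
      moreover have "w \<noteq> b" using w' u' le_antisym by blast
      ultimately show ?thesis by auto
    qed
    moreover have "a \<in> interval P r a u" using u' aP le_refl by (auto simp: interval_def)
    ultimately have "interval P r a u - {u} = {a}" using u' by auto
    then have "mobius P r a u = - mobius P r a a"
      using u' by (subst mobius.simps) (simp add: finite_carrier partial_order)
    also have "mobius P r a a = 1"
      using aP le_refl by (subst mobius.simps) (simp add: finite_carrier partial_order)
    finally show ?thesis .
  qed
  have split: "?I - {b} = insert a ?M" using vI neq by auto
  \<comment> \<open>The recursion now reads \<open>1 = - (1 - int (card ?M))\<close>.\<close>
  have "mobius P r a b = - (\<Sum>u\<in>?I - {b}. mobius P r a u)"
    using ab neq by (subst mobius.simps) (simp add: finite_carrier partial_order)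
  also have "\<dots> = - (mobius P r a a + (\<Sum>u\<in>?M. mobius P r a u))"
    unfolding split using finI by (subst sum.insert) auto
  also have "(\<Sum>u\<in>?M. mobius P r a u) = - int (card ?M)" using atom by simp
  also have "mobius P r a a = 1"
    using aP le_refl by (subst mobius.simps) (simp add: finite_carrier partial_order)
  finally show ?thesis using mu open_interval by simp
qed

text \<open>The order complex of \<open>P\<close> is a cone with apex \<open>z\<close>. Putting
  \<open>z\<close> back provides the element below \<open>v\<close> that \<open>diamond\<close> asks
  for.\<close>

lemma facets_order_complex_insert_minimum:
  assumes "partial_order_on P r" "is_minimum P r z" "F \<in> facets (order_complex (P - {z}) r)"
  shows "insert z F \<in> facets (order_complex P r)"
proof -
  have F: "F \<in> order_complex (P - {z}) r" using assms(3) by (simp add: facets_def)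
  have z: "z \<in> P" "\<And>x. x \<in> P \<Longrightarrow> (z, x) \<in> r" using assms(2) by (auto simp: is_minimum_def)
  have "insert z F \<in> order_complex P r" using F z by (auto simp: order_complex_def Chains_def)
  moreover have "G = insert z F" if "G \<in> order_complex P r" "insert z F \<subseteq> G" for G
  proof -
    have "G - {z} \<in> order_complex (P - {z}) r" using that by (auto simp: order_complex_def Chains_def)
    moreover have "F \<subseteq> G - {z}" using that F by (auto simp: order_complex_def)
    ultimately have "G - {z} = F" using assms(3) by (auto simp: facets_def)
    then show ?thesis using that by auto
  qed
  ultimately show ?thesis unfolding facets_def by blast
qed

text \<open>By the diamond property a codimension-one face below a fixed maximal element lies in exactly
  two facets, so the cycle condition there reads \<open>c(F) + c(G) = 0\<close>.\<close>

lemma cycle_eq_0_iff_flip: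
  fixes c :: "'a list \<Rightarrow> 'k::field"
  assumes eul: "lower_eulerian P r" and z: "is_minimum P r z" and y: "y \<in> maximal_elements P r"
    and c: "c \<in> cycles (order_complex (P - {z}) r) i"
    and flip: "facet_flip (order_complex (P - {z}) r) {y} F G"
    and xs: "distinct xs" "set xs = F" and ys: "distinct ys" "set ys = G"
  shows "c xs = 0 \<longleftrightarrow> c ys = 0"
proof -
  interpret finite_poset P r using eul by unfold_locales (simp_all add: lower_eulerian_def)
  let ?D = "order_complex (P - {z}) r"
  interpret D: simplicial_complex ?D by (rule simplicial_complex_order_complex) auto
  have alt: "alternating c" and supp: "\<And>xs. c xs \<noteq> 0 \<Longrightarrow> distinct xs \<and> set xs \<in> ?D"
    and bd: "\<And>w. (\<Sum>v\<in>\<Union>?D. c (v # w)) = 0"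
    using c by (auto simp: cycles_def oriented_chains_iff boundary_map_def fun_eq_iff)
  obtain \<tau> v w where \<tau>: "y \<in> \<tau>" "v \<notin> \<tau>" "w \<notin> \<tau>" "F = insert v \<tau>" "G = insert w \<tau>"
    and FG: "F \<in> facets ?D" "G \<in> facets ?D"
    using flip unfolding facet_flip_def by auto
  show ?thesis
  proof (cases "v = w")
    case True
    then show ?thesis using \<tau> alternating_eq_0_iff[OF alt xs(1) ys(1)] xs ys by simp
  next
    case False
    have sub: "F \<in> ?D" "G \<in> ?D" "F \<subseteq> P - {z}" "G \<subseteq> P - {z}"
      using FG by (auto simp: facets_def order_complex_iff)
    have ins: "insert v (insert z \<tau>) \<in> facets (order_complex P r)"
      "insert w (insert z \<tau>) \<in> facets (order_complex P r)"
      using FG[THEN facets_order_complex_insert_minimum[OF partial_order z]]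
      unfolding \<tau>(4,5) by (simp_all add: insert_commute[of z])
    have vz: "v \<in> P" "v \<noteq> z" "w \<in> P" "w \<noteq> z" using sub \<tau> by auto
    let ?U = "{u \<in> P - insert z \<tau>. insert u (insert z \<tau>) \<in> order_complex P r}"
    \<comment> \<open>Here \<open>z\<close> is the element below \<open>v\<close> and
      \<open>y\<close> the one above it; maximality of \<open>y\<close> excludes the other
      order.\<close>
    have "card ?U = 2"
    proof (rule diamond)
      show "graded (interval P r x y) r \<and> mobius P r x y = (- 1) ^ rho P r x y" if "(x, y) \<in> r" for x y
        using eul that le_carrier by (auto simp: lower_eulerian_def)
      show "(z, v) \<in> r" using z vz by (auto simp: is_minimum_def)
      have "(v, y) \<in> r \<or> (y, v) \<in> r" using sub(1) \<tau> by (auto simp: order_complex_iff)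
      moreover have "v = y" if "(y, v) \<in> r" using y vz that by (auto simp: maximal_elements_def)
      ultimately show "(v, y) \<in> r" using \<tau> by auto
    qed (use ins vz \<tau> in auto)
    moreover have "{v, w} \<subseteq> ?U" using ins vz \<tau> by (auto simp: facets_def)
    ultimately have U: "?U = {v, w}"
      using False finite_carrier by (intro card_subset_eq[symmetric]) auto
    have fin: "finite \<tau>" using D.finite_face[OF sub(1)] \<tau> by auto
    let ?t = "listing \<tau>"
    note t = listing[OF fin]
    have "0 = (\<Sum>u\<in>\<Union>?D. c (u # ?t))" using bd by simp
    also have "\<dots> = (\<Sum>u\<in>{v, w}. c (u # ?t))"
    proof (rule sum.mono_neutral_right[OF D.finite_vertices])
      show "{v, w} \<subseteq> \<Union>?D" using sub(1,2) \<tau> by auto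
      show "\<forall>u\<in>\<Union>?D - {v, w}. c (u # ?t) = 0"
      proof (rule ballI, rule ccontr)
        fix u assume u: "u \<in> \<Union>?D - {v, w}" "c (u # ?t) \<noteq> 0"
        then have *: "u \<notin> \<tau>" "insert u \<tau> \<in> ?D" using supp[OF u(2)] t by auto
        then have "u \<in> ?U"
          using z by (auto simp: order_complex_iff is_minimum_def)
        then show False using U u by auto
      qed
    qed
    also have "\<dots> = c (v # ?t) + c (w # ?t)" using False by simp
    finally have "c (v # ?t) = 0 \<longleftrightarrow> c (w # ?t) = 0"
      by (metis add.right_neutral add.left_neutral)
    moreover have "c xs = 0 \<longleftrightarrow> c (v # ?t) = 0" "c ys = 0 \<longleftrightarrow> c (w # ?t) = 0"
      using \<tau> t xs ys by (intro alternating_eq_0_iff[OF alt]; simp)+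
    ultimately show ?thesis by simp
  qed
qed

text \<open>The facets through \<open>y\<close> are connected by flips that keep \<open>y\<close>,
  and each flip preserves vanishing.\<close>

lemma cycle_eq_0_iff_facets:
  fixes c :: "'a list \<Rightarrow> 'k::field"
  assumes eul: "lower_eulerian P r" and z: "is_minimum P r z" and y: "y \<in> maximal_elements P r"
    and cm: "cohen_macaulay_complex TYPE('k) (order_complex (P - {z}) r)"
    and c: "c \<in> cycles (order_complex (P - {z}) r) i"
    and xs: "distinct xs" "set xs \<in> facets (order_complex (P - {z}) r)" "y \<in> set xs"
    and ys: "distinct ys" "set ys \<in> facets (order_complex (P - {z}) r)" "y \<in> set ys"
  shows "c xs = 0 \<longleftrightarrow> c ys = 0"
proof -
  interpret finite_poset P r using eul by unfold_locales (simp_all add: lower_eulerian_def)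
  let ?D = "order_complex (P - {z}) r"
  interpret D: simplicial_complex ?D by (rule simplicial_complex_order_complex) auto
  have "{y} \<in> ?D" using D.down_closed[of "set xs" "{y}"] xs by (auto simp: facets_def)
  then have "(facet_flip ?D {y})\<^sup>*\<^sup>* (set xs) (set ys)"
    using D.strongly_connected_star[OF cm] xs ys by auto
  \<comment> \<open>Flips relate sets and not lists, so the induction speaks of all orderings of the
    current facet.\<close>
  then have "\<forall>ws. distinct ws \<longrightarrow> set ws = set ys \<longrightarrow> (c xs = 0 \<longleftrightarrow> c ws = 0)"
  proof induction
    case base
    have "alternating c" using c by (simp add: cycles_def oriented_chains_iff)
    then show ?case using alternating_eq_0_iff[of c xs] xs(1) by auto
  next
    case (step F G)
    have "finite F" using step.hyps(2) D.finite_face by (auto simp: facet_flip_def facets_def)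
    from listing[OF this] show ?case
      using step.IH cycle_eq_0_iff_flip[OF eul z y c step.hyps(2), of "listing F"] by blast
  qed
  then show ?thesis using ys by blast
qed

section \<open>Top cycles, atoms and the double count\<close>

theorem theorem1p1:
  fixes P :: "'a set" and r :: "'a rel" and z :: 'a
  assumes "lower_eulerian P r"
    and "cohen_macaulay_poset TYPE('k::field) P r"
    and "is_minimum P r z"
  shows "(\<Sum>x\<in>atoms P r z. \<bar>mobius (hat_carrier P) (hat_rel P r) (Some x) None\<bar>)
    \<ge> int (alpha P r z) * \<bar>mobius (hat_carrier P) (hat_rel P r) (Some z) None\<bar>"
proof -
  note eul = assms(1) and z = assms(3)
  interpret finite_poset P r using eul by unfold_locales (simp_all add: lower_eulerian_def)
  let ?mu = "\<lambda>x. mobius (hat_carrier P) (hat_rel P r) (Some x) None"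
  let ?A = "atoms P r z"
  let ?Q = "P - {z}"
  let ?D = "order_complex ?Q r"
  let ?M = "maximal_elements P r"
  let ?up = "\<lambda>x. {w \<in> P. (x, w) \<in> r \<and> w \<noteq> x}"
  interpret D: simplicial_complex ?D by (rule simplicial_complex_order_complex) auto
  have zP: "z \<in> P" and zle: "\<And>x. x \<in> P \<Longrightarrow> (z, x) \<in> r" using z by (auto simp: is_minimum_def)
  have finA: "finite ?A" using finite_carrier by (simp add: atoms_def)
  have finM: "finite ?M" using finite_carrier by (simp add: maximal_elements_def)
  have cmP: "cohen_macaulay_complex TYPE('k) (order_complex P r)"
    using assms(2) by (simp add: cohen_macaulay_poset_def)
  \<comment> \<open>The link of \<open>z\<close> is the order complex of the rest, which thereby
    inherits the Cohen-Macaulay property.\<close>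
  have "link (order_complex P r) {z} = ?D"
    using link_order_complex_vertex[OF zP subset_refl] zle
    by (auto intro!: arg_cong[where f = "\<lambda>A. order_complex A r"])
  moreover have "{z} \<in> order_complex P r" using zP le_refl by (auto simp: order_complex_iff)
  ultimately have cm: "cohen_macaulay_complex TYPE('k) ?D"
    using cohen_macaulay_link[OF cmP] by metis
  have dim_mobius: "int (fs.dim (cycles L (complex_dim L) :: ('a list \<Rightarrow> 'k) set)) = \<bar>?mu x\<bar>"
    if "L = order_complex (?up x) r" "x \<in> P" "cohen_macaulay_complex TYPE('k) L" for L x
  proof -
    interpret L: simplicial_complex L
      unfolding that(1) by (rule simplicial_complex_order_complex) auto
    have "link L {} = L" by (auto simp: mem_link_iff)
    then have "reduced_homology_vanishes TYPE('k) L i" if "i < complex_dim L" for i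
      using \<open>cohen_macaulay_complex TYPE('k) L\<close> L.empty_face that
      unfolding cohen_macaulay_complex_def by metis
    from L.dim_cycles_top[OF this] show ?thesis
      using mobius_hat[OF that(2)] by (simp add: that(1) chi_def)
  qed
  have up_z: "?Q = ?up z" using zle by auto
  show ?thesis
  proof (cases "?Q = {}")
    case True
    \<comment> \<open>There are no atoms and \<open>alpha\<close> is 0, so both sides
      vanish.\<close>
    then have P: "P = {z}" using zP by auto
    have "?M = {z}" "?A = {}" using le_refl[OF zP] by (auto simp: maximal_elements_def atoms_def P)
    then show ?thesis by (simp add: alpha_def)
  next
    case False
    define d where "d = complex_dim ?D"
    let ?Z = "cycles ?D d :: ('a list \<Rightarrow> 'k) set"
    have MQ: "y \<in> ?Q" if "y \<in> ?M" for y
      using that False zle by (auto simp: maximal_elements_def)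
    have vertex: "{x} \<in> ?D" if "x \<in> ?Q" for x using that le_refl by (auto simp: order_complex_iff)
    have "\<forall>y\<in>?M. \<exists>F. F \<in> facets ?D \<and> y \<in> F"
      using D.facet_containing[OF vertex[OF MQ]] by auto
    \<comment> \<open>The coefficient at the listing of the chosen facet \<open>F y\<close> is the
      coordinate belonging to \<open>y\<close>.\<close>
    from bchoice[OF this] obtain F where F: "\<And>y. y \<in> ?M \<Longrightarrow> F y \<in> facets ?D \<and> y \<in> F y" by blast
    have facet_listing: "distinct (listing G)" "set (listing G) = G" if "G \<in> facets ?D" for G
      using that listing[of G] D.finite_face[of G] by (simp_all add: facets_def)
    \<comment> \<open>A simplex with nonzero coefficient has top dimension, so it is a facet and its
      greatest element \<open>y\<close> is maximal in \<open>P\<close>. Then the coordinate at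
      \<open>y\<close> is nonzero as well.\<close>
    have det: "c = (\<lambda>w. 0)" if c: "c \<in> ?Z" and 0: "\<And>y. y \<in> ?M \<Longrightarrow> c (listing (F y)) = 0" for c
    proof
      fix xs
      show "c xs = 0"
      proof (rule ccontr)
        assume nz: "c xs \<noteq> 0"
        then have xs: "distinct xs" "set xs \<in> ?D" "int (length xs) = d + 1"
          using c by (auto simp: cycles_def oriented_chains_iff)
        have card: "int (card (set xs)) = d + 1" using xs by (simp add: distinct_card)
        have facet: "set xs \<in> facets ?D"
        proof -
          obtain G where G: "G \<in> facets ?D" "set xs \<subseteq> G" using D.facet_containing[OF xs(2)] .
          then have "card G = card (set xs)" using D.card_facet[OF cm G(1)] card by (simp add: d_def)
          then have "set xs = G" using G D.finite_face by (intro card_subset_eq) (auto simp: facets_def)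
          then show ?thesis using G by simp
        qed
        obtain q where "{q} \<in> ?D" using False vertex by blast
        moreover have "G = set xs" if "G \<in> ?D" "set xs \<subseteq> G" for G
          using facet that by (auto simp: facets_def)
        ultimately have "set xs \<noteq> {}" by (metis empty_subsetI insert_not_empty)
        then obtain y where y: "y \<in> set xs" "\<And>u. u \<in> set xs \<Longrightarrow> (u, y) \<in> r"
          using chain_max[OF finite_set _ xs(2)] by metis
        have "y \<in> ?M"
          unfolding maximal_elements_def
        proof (intro CollectI conjI ballI impI)
          show "y \<in> P" using y le_carrier by blast
          fix u assume u: "u \<in> P" "(y, u) \<in> r"
          have "y \<noteq> z" using y xs(2) by (auto simp: order_complex_iff)
          then have "u \<noteq> z" using u zle[of y] \<open>y \<in> P\<close> le_antisym by blast
          have "insert u (set xs) \<in> ?D"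
            using insert_order_complex[OF xs(2), of u] u y(2) \<open>u \<noteq> z\<close> le_trans by blast
          then have "u \<in> set xs" using facet by (auto simp: facets_def)
          then show "u = y" using y(2) u le_antisym by blast
        qed
        then have "c xs = 0 \<longleftrightarrow> c (listing (F y)) = 0"
          using c facet xs(1) y(1) F facet_listing
          by (intro cycle_eq_0_iff_facets[OF eul z _ cm, of y]) auto
        then show False using nz 0 \<open>y \<in> ?M\<close> by simp
      qed
    qed
    have "\<exists>S u. S \<subseteq> ?M \<and> card S = fs.dim ?Z \<and> (\<forall>s\<in>S. u s \<in> ?Z \<and>
        u s (listing (F s)) = 1 \<and> (\<forall>t\<in>S. t \<noteq> s \<longrightarrow> u s (listing (F t)) = 0))"
      using det by (intro ex_dual_basis subspace_cycles finM) auto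
    then obtain S u where S: "S \<subseteq> ?M" and card_S: "card S = fs.dim ?Z"
      and u: "\<forall>s\<in>S. u s \<in> ?Z \<and> u s (listing (F s)) = 1 \<and>
        (\<forall>t\<in>S. t \<noteq> s \<longrightarrow> u s (listing (F t)) = 0)"
      by blast
    have finS: "finite S" using S finM finite_subset by blast
    have mu_z: "\<bar>?mu z\<bar> = int (card S)"
      using dim_mobius[of ?D z] up_z zP cm card_S by (simp add: d_def)
    have mu_x: "int (card {y \<in> S. (x, y) \<in> r}) \<le> \<bar>?mu x\<bar>" if x: "x \<in> ?A" for x
    proof -
      have xQ: "x \<in> ?Q" and xP: "x \<in> P" using x by (auto simp: atoms_def)
      let ?L = "link ?D {x}"
      interpret L: simplicial_complex ?L by (rule D.simplicial_complex_link[OF vertex[OF xQ]])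
      \<comment> \<open>Only \<open>z\<close> lies strictly below an atom, so every other element of
        \<open>?Q\<close> comparable to \<open>x\<close> lies above it.\<close>
      have "{w \<in> ?Q. w \<noteq> x \<and> ((x, w) \<in> r \<or> (w, x) \<in> r)} = ?up x"
        using x zle le_antisym by (auto simp: atoms_def)
      then have L: "?L = order_complex (?up x) r"
        using link_order_complex_vertex[OF xQ] by auto
      have dimL: "complex_dim ?L = d - 1"
        unfolding d_def by (rule D.complex_dim_link_vertex[OF cm vertex[OF xQ]])
      let ?S = "{y \<in> S. (x, y) \<in> r}"
      have "\<forall>y\<in>?S. \<exists>G. G \<in> facets ?D \<and> x \<in> G \<and> y \<in> G"
      proof
        fix y assume "y \<in> ?S"
        then have "{x, y} \<in> ?D" using S MQ xQ le_refl by (auto simp: order_complex_iff)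
        then obtain G where "G \<in> facets ?D" "{x, y} \<subseteq> G" by (rule D.facet_containing)
        then show "\<exists>G. G \<in> facets ?D \<and> x \<in> G \<and> y \<in> G" by auto
      qed
      from bchoice[OF this] obtain G where G: "\<And>y. y \<in> ?S \<Longrightarrow> G y \<in> facets ?D \<and> x \<in> G y \<and> y \<in> G y" by blast
      let ?w = "\<lambda>y. listing (G y - {x})"
      have w: "distinct (x # ?w y)" "set (x # ?w y) = G y" if "y \<in> ?S" for y
        using G[OF that] listing[of "G y - {x}"] D.finite_face[of "G y"] by (auto simp: facets_def)
      \<comment> \<open>Both lists enumerate facets through \<open>t\<close>. Hence the diagonal
        vanishing pattern of \<open>u\<close> at the \<open>F t\<close> persists at facets that also
        contain \<open>x\<close>, which makes the link cycles \<open>u y (x # w)\<close>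
        independent.\<close>
      have iff: "u s (x # ?w t) = 0 \<longleftrightarrow> u s (listing (F t)) = 0" if "s \<in> S" "t \<in> ?S" for s t
      proof (rule cycle_eq_0_iff_facets[OF eul z _ cm, of t])
        show t: "t \<in> ?M" using that S by auto
        show "u s \<in> ?Z" using u that by blast
        show "distinct (x # ?w t)" "set (x # ?w t) \<in> facets ?D" "t \<in> set (x # ?w t)"
          using w[OF that(2)] G[OF that(2)] by auto
        show "distinct (listing (F t))" "set (listing (F t)) \<in> facets ?D" "t \<in> set (listing (F t))"
          using F[OF t] facet_listing[of "F t"] by auto
      qed
      obtain T :: "('a list \<Rightarrow> 'k) set" where T: "finite T" "oriented_chains ?L (d - 1) \<subseteq> fs.span T"
        using dim_oriented_chains(2)[OF L.finite_complex L.finite_face] by blast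
      have "card ?S \<le> fs.dim (cycles ?L (d - 1) :: ('a list \<Rightarrow> 'k) set)"
      proof (rule card_le_dim_triangular[where u = "\<lambda>y w. u y (x # w)" and p = ?w])
        show "u s (x # ?w s) \<noteq> 0" if "s \<in> ?S" for s using iff[of s s] u that by auto
        show "u s (x # ?w t) = 0" if "s \<in> ?S" "t \<in> ?S" "s \<noteq> t" for s t
          using iff[of s t] u that by auto
        show "(\<lambda>y w. u y (x # w)) ` ?S \<subseteq> cycles ?L (d - 1)"
          using u by (auto intro!: D.cycle_link_vertex)
        show "cycles ?L (d - 1) \<subseteq> fs.span T" using T(2) by (auto simp: cycles_def)
      qed (use finS T in auto)
      also have "int \<dots> = \<bar>?mu x\<bar>"
        using dim_mobius[OF L xP cohen_macaulay_link[OF cm vertex[OF xQ]]] by (simp add: dimL)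
      finally show ?thesis by simp
    qed
    have alpha_le: "alpha P r z \<le> card {x \<in> ?A. (x, y) \<in> r}" if "y \<in> S" for y
      unfolding alpha_def using that S finM by (intro Min_le) auto
    \<comment> \<open>Pairs of some \<open>y\<close> in \<open>S\<close> and an atom below it are
      counted first by \<open>y\<close>, with at least \<open>alpha\<close> atoms each, and then by
      atom.\<close>
    have "int (alpha P r z) * \<bar>?mu z\<bar> = (\<Sum>y\<in>S. int (alpha P r z))" by (simp add: mu_z)
    also have "\<dots> \<le> (\<Sum>y\<in>S. int (card {x \<in> ?A. (x, y) \<in> r}))"
      using alpha_le by (intro sum_mono) simp
    also have "\<dots> = (\<Sum>y\<in>S. \<Sum>x\<in>?A. if (x, y) \<in> r then 1 else 0)"
      using finA by (simp add: sum.If_cases Int_def)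
    also have "\<dots> = (\<Sum>x\<in>?A. \<Sum>y\<in>S. if (x, y) \<in> r then 1 else 0)" by (rule sum.swap)
    also have "\<dots> = (\<Sum>x\<in>?A. int (card {y \<in> S. (x, y) \<in> r}))"
      using finS by (simp add: sum.If_cases Int_def)
    also have "\<dots> \<le> (\<Sum>x\<in>?A. \<bar>?mu x\<bar>)" using mu_x by (rule sum_mono)
    finally show ?thesis .
  qed
qed

end
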